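(* Suppose $\kappa$ is inaccessible, $\dagger(\kappa, f, g)$ holds, and $\mathfrak{U} = (\chi, \mathcal{S})$ is a universal algebra with $2 \leq |\chi| < \kappa$. Then there is a homomorphic projection $\mathcal{E}_0: \mathfrak{U}^{\kappa}/\sim \to \mathfrak{U}^{\kappa}/\sim$ (i.e. a homomorphism with $\mathcal{E}_0\circ\mathcal{E}_0=\mathcal{E}_0$), whose image is isomorphic to $\mathfrak{U}^{\kappa}/\sim$, such that every homomorphism $\Delta: \mathfrak{U}^{\kappa} \to \mathfrak{U}^{\kappa}$ with $p_{\sim}\circ\Delta = \mathcal{E}_0\circ p_{\sim}$ satisfies, for every cardinal $\lambda < \kappa$, $$|\{\alpha \in \kappa: \pi_{\alpha} \circ \Delta\text{ has no strong support of cardinality} \leq \lambda\}| = \kappa.$$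
   Context: For $f,g \in {}^{\kappa}\mathrm{Card}$, $\mathfrak{d}_{f,g}$ is the least cardinality of a family $\mathcal{D} \subseteq \prod_{\nu\in\kappa}[f(\nu)]^{g(\nu)}$ such that for every $F \in \prod_{\nu\in\kappa} f(\nu)$ there are $G \in \mathcal{D}$ and $\beta\in\kappa$ with $F(\nu) \in G(\nu)$ for all $\nu \in \kappa\setminus\beta$. $\dagger(\kappa,f,g)$ means: $f,g: \kappa \to \kappa \cap \mathrm{Card}$, all $f(\nu),g(\nu)$ infinite regular cardinals, and (1) $2^{g(\nu)} < f(\nu)$; (2) if $\nu < \nu^*$ then $|\nu| \le g(\nu) \le g(\nu^* )$; (3) $\mathfrak{d}_{2^{f},g} = \kappa^+$ where $2^f(\nu)=2^{f(\nu)}$. $\sigma\sim\tau$ in $\mathfrak{U}^{\kappa}$ means $|\{\alpha:\sigma(\alpha)\ne\tau(\alpha)\}|<\kappa$; $p_\sim$ is the quotient homomorphism; $\pi_\alpha$ is the $\alpha$-th coordinate projection. For a homomorphism $\Theta: \mathfrak{U}^{Z} \to \mathfrak{M}$, $Y \subseteq Z$ is a strong support if (i) $\sigma \upharpoonright Y = \tau \upharpoonright Y$ implies $\Theta\sigma = \Theta\tau$, and (ii) for each $y \in Y$ and $\sigma$ there is $x \in \chi$ such that changing the $y$-th coordinate of $\sigma$ to $x$ changes the value of $\Theta$. *)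

theory Defs
  imports Main "HOL-Library.FuncSet"
begin

unbundle cardinal_syntax

section \<open>Cardinals\<close>

text \<open>
  A cardinal \<open>\<kappa>\<close> is a cardinal order in the sense of the library, i.e. a well-order of minimal
  order type among the well-orders of its field. An ordinal \<open>\<nu> \<in> \<kappa>\<close> is an element of
  \<^term>\<open>Field \<kappa>\<close>; the von Neumann identification of \<open>\<nu>\<close> with the set of its predecessors is
  rendered by \<open>seg \<kappa> \<nu>\<close>. In particular \<open>\<nu>\<close> is a cardinal iff \<open>seg \<kappa> \<nu>\<close> is a cardinal order.
\<close>

definition seg :: "'k rel \<Rightarrow> 'k \<Rightarrow> 'k rel" where
  "seg \<kappa> \<nu> = Restr \<kappa> (underS \<kappa> \<nu>)"

definition cards_below :: "'k rel \<Rightarrow> 'k set" where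
  "cards_below \<kappa> = {\<nu> \<in> Field \<kappa>. Card_order (seg \<kappa> \<nu>)}"

definition inaccessible :: "'k rel \<Rightarrow> bool" where
  "inaccessible \<kappa> \<longleftrightarrow>
     Card_order \<kappa> \<and> natLeq <o \<kappa> \<and> regularCard \<kappa> \<and>
     (\<forall>\<nu>\<in>cards_below \<kappa>. BNF_Cardinal_Arithmetic.ctwo ^c seg \<kappa> \<nu> <o \<kappa>)"

text \<open>
  For \<open>\<kappa>\<close>-sequences \<open>f\<close>, \<open>g\<close> of cardinals, the families over which the minimum
  \<open>\<dd>\<^bsub>f,g\<^esub>\<close> is taken. Here \<open>[X]\<^bsup>\<mu>\<^esup>\<close> is the set of subsets of \<open>X\<close> of cardinality exactly \<open>\<mu>\<close>.
\<close>

definition dominating_family ::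
  "'k rel \<Rightarrow> ('k \<Rightarrow> 'b rel) \<Rightarrow> ('k \<Rightarrow> 'c rel) \<Rightarrow> ('k \<Rightarrow> 'b set) set \<Rightarrow> bool" where
  "dominating_family \<kappa> f g D \<longleftrightarrow>
     D \<subseteq> (\<Pi>\<^sub>E \<nu>\<in>Field \<kappa>. {A. A \<subseteq> Field (f \<nu>) \<and> |A| =o g \<nu>}) \<and>
     (\<forall>F \<in> (\<Pi>\<^sub>E \<nu>\<in>Field \<kappa>. Field (f \<nu>)).
        \<exists>G\<in>D. \<exists>\<beta>\<in>Field \<kappa>. \<forall>\<nu>\<in>Field \<kappa> - underS \<kappa> \<beta>. F \<nu> \<in> G \<nu>)"

text \<open>\<open>dnum_is \<kappa> f g \<mu>\<close> says \<open>\<dd>\<^bsub>f,g\<^esub> = \<mu>\<close>. It is a relation because the minimum need not exist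
  for arbitrary \<open>f\<close>, \<open>g\<close>.\<close>

definition dnum_is ::
  "'k rel \<Rightarrow> ('k \<Rightarrow> 'b rel) \<Rightarrow> ('k \<Rightarrow> 'c rel) \<Rightarrow> 'd rel \<Rightarrow> bool" where
  "dnum_is \<kappa> f g \<mu> \<longleftrightarrow>
     (\<exists>D. dominating_family \<kappa> f g D \<and> |D| =o \<mu>) \<and>
     (\<forall>D. dominating_family \<kappa> f g D \<longrightarrow> \<mu> \<le>o |D| )"

definition dagger :: "'k rel \<Rightarrow> ('k \<Rightarrow> 'k) \<Rightarrow> ('k \<Rightarrow> 'k) \<Rightarrow> bool" where
  "dagger \<kappa> f g \<longleftrightarrow>
     f \<in> Field \<kappa> \<rightarrow> cards_below \<kappa> \<and> g \<in> Field \<kappa> \<rightarrow> cards_below \<kappa> \<and>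
     (\<forall>\<nu>\<in>Field \<kappa>.
        BNF_Cardinal_Arithmetic.cinfinite (seg \<kappa> (f \<nu>)) \<and> regularCard (seg \<kappa> (f \<nu>)) \<and>
        BNF_Cardinal_Arithmetic.cinfinite (seg \<kappa> (g \<nu>)) \<and> regularCard (seg \<kappa> (g \<nu>))) \<and>
     (\<forall>\<nu>\<in>Field \<kappa>. BNF_Cardinal_Arithmetic.ctwo ^c seg \<kappa> (g \<nu>) <o seg \<kappa> (f \<nu>)) \<and>
     (\<forall>\<nu>'\<in>Field \<kappa>. \<forall>\<nu>\<in>underS \<kappa> \<nu>'.
        |underS \<kappa> \<nu>| \<le>o seg \<kappa> (g \<nu>) \<and> seg \<kappa> (g \<nu>) \<le>o seg \<kappa> (g \<nu>')) \<and>
     dnum_is \<kappa> (\<lambda>\<nu>. BNF_Cardinal_Arithmetic.ctwo ^c seg \<kappa> (f \<nu>)) (\<lambda>\<nu>. seg \<kappa> (g \<nu>)) (cardSuc \<kappa>)"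

section \<open>Universal algebras\<close>

text \<open>
  Operations are finitary and indexed by a (possibly empty) set of symbols, so that algebras
  of the same signature can be compared.
\<close>

record ('i, 'a) ualg =
  ucarrier :: "'a set"
  usyms :: "'i set"
  uarity :: "'i \<Rightarrow> nat"
  uop :: "'i \<Rightarrow> 'a list \<Rightarrow> 'a"

definition uargs :: "('i, 'a) ualg \<Rightarrow> 'i \<Rightarrow> 'a list set" where
  "uargs M s = {xs. length xs = uarity M s \<and> set xs \<subseteq> ucarrier M}"

definition universal_algebra :: "('i, 'a) ualg \<Rightarrow> bool" where
  "universal_algebra M \<longleftrightarrow> (\<forall>s\<in>usyms M. \<forall>xs\<in>uargs M s. uop M s xs \<in> ucarrier M)"

definition uhom :: "('i, 'a) ualg \<Rightarrow> ('i, 'b) ualg \<Rightarrow> ('a \<Rightarrow> 'b) set" where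
  "uhom M N = {h. usyms M = usyms N \<and> (\<forall>s\<in>usyms M. uarity M s = uarity N s) \<and>
     h \<in> ucarrier M \<rightarrow> ucarrier N \<and>
     (\<forall>s\<in>usyms M. \<forall>xs\<in>uargs M s. h (uop M s xs) = uop N s (map h xs))}"

definition uisomorphic :: "('i, 'a) ualg \<Rightarrow> ('i, 'b) ualg \<Rightarrow> bool" where
  "uisomorphic M N \<longleftrightarrow> (\<exists>h\<in>uhom M N. bij_betw h (ucarrier M) (ucarrier N))"

definition uimage :: "('a \<Rightarrow> 'b) \<Rightarrow> ('i, 'a) ualg \<Rightarrow> ('i, 'b) ualg \<Rightarrow> ('i, 'b) ualg" where
  "uimage h M N = N\<lparr>ucarrier := h ` ucarrier M\<rparr>"

definition upower :: "('i, 'a) ualg \<Rightarrow> 'z set \<Rightarrow> ('i, 'z \<Rightarrow> 'a) ualg" where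
  "upower M Z = \<lparr>ucarrier = (\<Pi>\<^sub>E z\<in>Z. ucarrier M), usyms = usyms M, uarity = uarity M,
     uop = (\<lambda>s xs. \<lambda>z\<in>Z. uop M s (map (\<lambda>\<sigma>. \<sigma> z) xs))\<rparr>"

text \<open>For a congruence \<open>R\<close>, all the classes in the union below coincide.\<close>

definition uquot :: "('i, 'a) ualg \<Rightarrow> 'a rel \<Rightarrow> ('i, 'a set) ualg" where
  "uquot M R = \<lparr>ucarrier = ucarrier M // R, usyms = usyms M, uarity = uarity M,
     uop = (\<lambda>s Cs. \<Union>xs\<in>listset Cs. R `` {uop M s xs})\<rparr>"

definition sim :: "('i, 'a) ualg \<Rightarrow> 'k rel \<Rightarrow> ('k \<Rightarrow> 'a) rel" where
  "sim M \<kappa> = {(\<sigma>, \<tau>). \<sigma> \<in> ucarrier (upower M (Field \<kappa>)) \<and> \<tau> \<in> ucarrier (upower M (Field \<kappa>)) \<and>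
     |{\<alpha> \<in> Field \<kappa>. \<sigma> \<alpha> \<noteq> \<tau> \<alpha>}| <o \<kappa>}"

definition strong_support ::
  "('i, 'a) ualg \<Rightarrow> 'z set \<Rightarrow> (('z \<Rightarrow> 'a) \<Rightarrow> 'm) \<Rightarrow> 'z set \<Rightarrow> bool" where
  "strong_support M Z \<Theta> Y \<longleftrightarrow> Y \<subseteq> Z \<and>
     (\<forall>\<sigma>\<in>ucarrier (upower M Z). \<forall>\<tau>\<in>ucarrier (upower M Z).
        restrict \<sigma> Y = restrict \<tau> Y \<longrightarrow> \<Theta> \<sigma> = \<Theta> \<tau>) \<and>
     (\<forall>y\<in>Y. \<forall>\<sigma>\<in>ucarrier (upower M Z). \<exists>x\<in>ucarrier M. \<Theta> (\<sigma>(y := x)) \<noteq> \<Theta> \<sigma>)"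

end

theory Submission
  imports Defs
begin

text \<open>
  Split \<open>\<kappa>\<close> into blocks of size \<open>f(x)\<close>, \<open>x < \<kappa>\<close>, and enumerate a dominating family as \<open>G\<^sub>\<xi>\<close>,
  \<open>\<xi> < \<kappa>\<^sup>+\<close>. By recursion on \<open>\<xi>\<close> one chooses maps \<open>r\<^sub>\<xi>\<close> of every block into itself, equal to the identity
  from a bound \<open>b\<^sub>\<xi>(x) < f(x)\<close> on, such that for \<open>\<eta> < \<xi>\<close> and almost all \<open>x\<close> the map \<open>r\<^sub>\<xi>\<close> extends the
  part of \<open>r\<^sub>\<eta>\<close> below \<open>b\<^sub>\<eta>(x)\<close> and preserves membership in the sets of \<open>G\<^sub>\<eta>(x)\<close> on the points from
  \<open>b\<^sub>\<eta>(x)\<close> on. Every point is moved at most once, so nothing has to survive at limit stages; at stage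
  \<open>\<xi>\<close> one new point \<open>m\<^sub>\<xi>(x)\<close> is moved to a point with the same type over the fewer than \<open>f(x)\<close> many
  relevant sets, which exists because \<open>2\<^bsup>g(x)\<^esup> < f(x)\<close>.

  Every \<open>\<sigma>\<close> is captured by some \<open>G\<^sub>\<eta>\<close>, hence the class of \<open>\<sigma> \<circ> r\<^sub>\<xi>\<close> is eventually constant in \<open>\<xi>\<close>, and
  this limit is a homomorphism. Doubling the coordinates into sources and targets and reading the
  targets off the sources turns it into a projection onto the power over the sources.

  Suppose a lift has small strong supports. If in cofinally many blocks the support of the target of
  cofinally many points \<open>y\<close> contains the source of some \<open>y' > y\<close>, a triangular choice gives \<open>\<sigma>\<close> such
  that the value at these targets differs from \<open>\<sigma>(y)\<close>, contradicting \<open>r\<^sub>\<xi> = id\<close> above \<open>b\<^sub>\<xi>\<close>. Otherwise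
  some stage moves \<open>m\<^sub>\<xi>(x)\<close> to a point whose source is outside the support of the target of
  \<open>m\<^sub>\<xi>(x)\<close>, and a triangular choice refutes this as well.
\<close>

section \<open>Regular cardinals\<close>

locale regular_cardinal =
  fixes \<kappa> :: "'k rel"
  assumes Card: "Card_order \<kappa>"
    and infinite: "\<not> finite (Field \<kappa>)"
    and regular: "regularCard \<kappa>"
begin

abbreviation le (infix \<open>\<sqsubseteq>\<close> 50) where "x \<sqsubseteq> y \<equiv> (x, y) \<in> \<kappa>"
abbreviation lt (infix \<open>\<sqsubset>\<close> 50) where "x \<sqsubset> y \<equiv> x \<in> underS \<kappa> y"

lemma wo: "wo_rel \<kappa>"
  using Card unfolding card_order_on_def wo_rel_def by auto

lemma Cinf: "BNF_Cardinal_Arithmetic.Cinfinite \<kappa>"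
  using Card infinite by (simp add: cinfinite_def)

lemma lt_iff: "x \<sqsubset> y \<longleftrightarrow> x \<sqsubseteq> y \<and> x \<noteq> y"
  by (auto simp: underS_def)

lemma le_Field: "x \<sqsubseteq> y \<Longrightarrow> x \<in> Field \<kappa> \<and> y \<in> Field \<kappa>"
  by (auto simp: Field_def)

lemma le_refl: "x \<in> Field \<kappa> \<Longrightarrow> x \<sqsubseteq> x"
  using wo_rel.REFL[OF wo] by (auto simp: refl_on_def)

lemma le_trans: "x \<sqsubseteq> y \<Longrightarrow> y \<sqsubseteq> z \<Longrightarrow> x \<sqsubseteq> z"
  using wo_rel.TRANS[OF wo] by (auto simp: trans_def)

lemma le_antisym: "x \<sqsubseteq> y \<Longrightarrow> y \<sqsubseteq> x \<Longrightarrow> x = y"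
  using wo_rel.ANTISYM[OF wo] by (auto simp: antisym_def)

lemma lt_le_trans: "x \<sqsubset> y \<Longrightarrow> y \<sqsubseteq> z \<Longrightarrow> x \<sqsubset> z"
  by (metis le_antisym le_trans lt_iff)

lemma le_lt_trans: "x \<sqsubseteq> y \<Longrightarrow> y \<sqsubset> z \<Longrightarrow> x \<sqsubset> z"
  by (metis le_antisym le_trans lt_iff)

lemma lt_trans: "x \<sqsubset> y \<Longrightarrow> y \<sqsubset> z \<Longrightarrow> x \<sqsubset> z"
  using lt_iff lt_le_trans by blast

lemma lt_irrefl: "\<not> x \<sqsubset> x"
  by (auto simp: lt_iff)

lemma not_lt: "x \<in> Field \<kappa> \<Longrightarrow> y \<in> Field \<kappa> \<Longrightarrow> \<not> x \<sqsubset> y \<longleftrightarrow> y \<sqsubseteq> x"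
  by (metis le_antisym le_refl lt_iff wo wo_rel.TOTALS)

lemma lt_total: "x \<in> Field \<kappa> \<Longrightarrow> y \<in> Field \<kappa> \<Longrightarrow> x \<noteq> y \<Longrightarrow> x \<sqsubset> y \<or> y \<sqsubset> x"
  by (metis lt_iff not_lt)

lemma wf_lt: "wf {(x, y). x \<sqsubset> y}"
  by (rule wf_subset[OF wo_rel.WF[OF wo]]) (auto simp: lt_iff)

lemma small_bounded:
  assumes "S \<subseteq> Field \<kappa>" "|S| <o \<kappa>"
  obtains b where "b \<in> Field \<kappa>" "\<And>s. s \<in> S \<Longrightarrow> s \<sqsubset> b"
proof -
  \<comment> \<open>A cofinal subset of a regular cardinal has full cardinality.
    \<open>cofinal\<close> speaks of strictly larger elements, so its failure bounds
    \<open>S\<close> only weakly, by some \<open>a\<close>; the strict bound is a later element,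
    which exists because \<kappa> has no maximum.\<close>
  have "\<not> cofinal S \<kappa>"
    using assms regular by (auto simp: regularCard_def dest: not_ordLess_ordIso)
  then obtain a where a: "a \<in> Field \<kappa>" "\<And>s. s \<in> S \<Longrightarrow> s \<sqsubseteq> a"
    using assms(1) not_lt lt_iff unfolding cofinal_def by (metis subsetD)
  obtain b where "a \<noteq> b" "a \<sqsubseteq> b"
    using infinite_Card_order_limit[OF Card infinite a(1)] by blast
  then show thesis
    using that a le_Field by (metis le_lt_trans lt_iff)
qed

lemma image_bounded:
  assumes "|S| <o \<kappa>" "h ` S \<subseteq> Field \<kappa>"
  obtains b where "b \<in> Field \<kappa>" "\<And>s. s \<in> S \<Longrightarrow> h s \<sqsubset> b"
  using small_bounded[OF assms(2)] ordLeq_ordLess_trans[OF card_of_image assms(1)]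
  by (metis imageI)

lemma bounded_small: "b \<in> Field \<kappa> \<Longrightarrow> |underS \<kappa> b| <o \<kappa>"
  using card_of_underS[OF Card] .

lemma ex_upper2:
  assumes "a \<in> Field \<kappa>" "b \<in> Field \<kappa>"
  obtains c where "c \<in> Field \<kappa>" "a \<sqsubset> c" "b \<sqsubset> c"
proof -
  obtain c where "c \<in> Field \<kappa>" "a \<sqsubseteq> c" "b \<sqsubseteq> c"
    using assms le_refl not_lt lt_iff by metis
  moreover then obtain d where "c \<sqsubset> d"
    using infinite_Card_order_limit[OF Card infinite] lt_iff by blast
  ultimately show thesis
    using that[of d] le_lt_trans le_Field lt_iff by metis
qed

lemma Field_Restr:
  assumes "S \<subseteq> Field \<kappa>"
  shows "Field (Restr \<kappa> S) = S"
proof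
  show "Field (Restr \<kappa> S) \<subseteq> S" by (auto simp: Field_def)
  show "S \<subseteq> Field (Restr \<kappa> S)"
  proof
    fix y assume "y \<in> S"
    then have "(y, y) \<in> Restr \<kappa> S" using assms le_refl by auto
    then show "y \<in> Field (Restr \<kappa> S)" by (rule FieldI1)
  qed
qed

definition unbounded :: "'k set \<Rightarrow> bool" where
  "unbounded X \<longleftrightarrow> X \<subseteq> Field \<kappa> \<and> (\<forall>b\<in>Field \<kappa>. \<exists>x\<in>X. b \<sqsubset> x)"

text \<open>A maximal subset of \<open>X\<^sub>0\<close> with the spacing property is unbounded:
  were it bounded, it and its \<open>h\<close>-image would be small, and a point of
  \<open>X\<^sub>0\<close> beyond both could be added. It serves to thin out both the set of blocks
  and the points inside a block, with \<open>h\<close> bounding what a support touches.\<close>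

lemma unbounded_sparse_subset:
  assumes "unbounded X\<^sub>0" "h ` Field \<kappa> \<subseteq> Field \<kappa>"
  obtains X where "X \<subseteq> X\<^sub>0" "unbounded X" "\<And>x x'. x \<in> X \<Longrightarrow> x' \<in> X \<Longrightarrow> x' \<sqsubset> x \<Longrightarrow> h x' \<sqsubset> x"
proof -
  define A where "A = {X. X \<subseteq> X\<^sub>0 \<and> (\<forall>x\<in>X. \<forall>x'\<in>X. x' \<sqsubset> x \<longrightarrow> h x' \<sqsubset> x)}"
  have "\<exists>M\<in>A. \<forall>X\<in>A. M \<subseteq> X \<longrightarrow> X = M"
  proof (rule subset_Zorn')
    fix C assume C: "subset.chain A C"
    have sub: "C \<subseteq> A" using C by (simp add: subset_chain_def)
    have lin: "\<And>X Y. X \<in> C \<Longrightarrow> Y \<in> C \<Longrightarrow> X \<subseteq> Y \<or> Y \<subseteq> X"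
      using C by (simp add: subset_chain_def)
    have "h x' \<sqsubset> x" if xx: "x \<in> \<Union>C" "x' \<in> \<Union>C" "x' \<sqsubset> x" for x x'
    proof -
      obtain X Y where "X \<in> C" "Y \<in> C" "x \<in> X" "x' \<in> Y" using xx by blast
      then obtain Z where "Z \<in> C" "x \<in> Z" "x' \<in> Z" using lin[of X Y] by blast
      then show ?thesis using sub xx(3) unfolding A_def by blast
    qed
    moreover have "\<Union>C \<subseteq> X\<^sub>0" using sub unfolding A_def by blast
    ultimately show "\<Union>C \<in> A" unfolding A_def by simp
  qed
  then obtain X where X: "X \<in> A" and max: "\<And>Y. Y \<in> A \<Longrightarrow> X \<subseteq> Y \<Longrightarrow> Y = X"
    by blast
  have X0: "X \<subseteq> X\<^sub>0" and Xh: "\<And>x x'. x \<in> X \<Longrightarrow> x' \<in> X \<Longrightarrow> x' \<sqsubset> x \<Longrightarrow> h x' \<sqsubset> x"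
    using X unfolding A_def by simp_all
  have sub: "X \<subseteq> Field \<kappa>" using assms(1) X0 by (auto simp: unbounded_def)
  have "unbounded X"
  proof (rule ccontr)
    assume "\<not> unbounded X"
    then obtain b where b: "b \<in> Field \<kappa>" "\<forall>x\<in>X. \<not> b \<sqsubset> x"
      using sub unfolding unbounded_def by blast
    then have b': "\<And>x. x \<in> X \<Longrightarrow> x \<sqsubseteq> b"
      using sub not_lt by blast
    obtain b\<^sub>1 where b1: "b\<^sub>1 \<in> Field \<kappa>" "b \<sqsubset> b\<^sub>1"
      by (rule ex_upper2[OF b(1) b(1)])
    have "X \<subseteq> underS \<kappa> b\<^sub>1"
      using b' b1 le_lt_trans by blast
    then have small: "|X| <o \<kappa>"
      using bounded_small[OF b1(1)] card_of_mono1 ordLeq_ordLess_trans by blast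
    have "h ` X \<subseteq> Field \<kappa>" using sub assms(2) by blast
    then obtain b\<^sub>2 where b2: "b\<^sub>2 \<in> Field \<kappa>" "\<And>x. x \<in> X \<Longrightarrow> h x \<sqsubset> b\<^sub>2"
      by (rule image_bounded[OF small]) blast
    obtain b\<^sub>3 where b3: "b\<^sub>3 \<in> Field \<kappa>" "b\<^sub>1 \<sqsubset> b\<^sub>3" "b\<^sub>2 \<sqsubset> b\<^sub>3"
      by (rule ex_upper2[OF b1(1) b2(1)])
    obtain x where x: "x \<in> X\<^sub>0" "b\<^sub>3 \<sqsubset> x"
      using assms(1) b3(1) unfolding unbounded_def by blast
    have above1: "y \<sqsubset> x" if "y \<in> X" for y
      using le_lt_trans[OF b'[OF that] b1(2)] lt_trans b3(2) x(2) by blast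
    have above2: "h y \<sqsubset> x" if "y \<in> X" for y
      using b2(2)[OF that] lt_trans b3(3) x(2) by blast
    have "h z \<sqsubset> y" if "y \<in> insert x X" "z \<in> insert x X" "z \<sqsubset> y" for y z
    proof -
      have "z \<in> X" using that above1 lt_irrefl lt_trans by (metis insert_iff)
      then show ?thesis using that Xh above2 by (metis insert_iff)
    qed
    then have "insert x X \<in> A"
      using X0 x(1) unfolding A_def by simp
    then have "x \<in> X" using max by blast
    then show False using above1 lt_irrefl by blast
  qed
  then show thesis using that X0 Xh by blast
qed

end

context regular_cardinal
begin

lemma underS_Field: "underS \<kappa> a \<subseteq> Field \<kappa>"
  by (auto simp: underS_def Field_def)

lemma Field_seg: "Field (seg \<kappa> a) = underS \<kappa> a"
  unfolding seg_def by (rule Field_Restr[OF underS_Field])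

lemma card_of_seg: "Card_order (seg \<kappa> a) \<Longrightarrow> |underS \<kappa> a| =o seg \<kappa> a"
  using card_of_Field_ordIso[of "seg \<kappa> a"] by (simp add: Field_seg)

lemma regular_cardSuc: "regular_cardinal (cardSuc \<kappa>)"
proof
  show "Card_order (cardSuc \<kappa>)" by (rule cardSuc_Card_order[OF Card])
  show "\<not> finite (Field (cardSuc \<kappa>))" using infinite cardSuc_finite[OF Card] by simp
  show "regularCard (cardSuc \<kappa>)" by (rule infinite_cardSuc_regularCard[OF infinite Card])
qed

end

text \<open>Requirement \<open>Bad w\<close> looks only at the coordinates in \<open>V w\<close> and
  can be met by adjusting the reserved coordinate \<open>z w\<close>. Since \<open>z w\<close>
  avoids \<open>V v\<close> for every earlier \<open>v\<close>, values fixed along \<open>R\<close>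
  never spoil a requirement already met.\<close>

lemma triangular_choice:
  fixes Bad :: "'w \<Rightarrow> ('z \<Rightarrow> 'a) \<Rightarrow> bool"
  assumes wf: "wf R"
    and total: "\<And>v w. v \<in> T \<Longrightarrow> w \<in> T \<Longrightarrow> v \<noteq> w \<Longrightarrow> (v, w) \<in> R \<or> (w, v) \<in> R"
    and z: "\<And>w. w \<in> T \<Longrightarrow> z w \<in> V w"
    and fresh: "\<And>v w. v \<in> T \<Longrightarrow> w \<in> T \<Longrightarrow> (v, w) \<in> R \<Longrightarrow> z w \<notin> V v"
    and local: "\<And>w \<sigma> \<tau>. w \<in> T \<Longrightarrow> \<sigma> \<in> (\<Pi>\<^sub>E i\<in>Z. A) \<Longrightarrow> \<tau> \<in> (\<Pi>\<^sub>E i\<in>Z. A) \<Longrightarrow>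
      (\<And>i. i \<in> V w \<Longrightarrow> \<sigma> i = \<tau> i) \<Longrightarrow> Bad w \<sigma> \<Longrightarrow> Bad w \<tau>"
    and step: "\<And>w \<sigma>. w \<in> T \<Longrightarrow> \<sigma> \<in> (\<Pi>\<^sub>E i\<in>Z. A) \<Longrightarrow> \<exists>c\<in>A. Bad w (\<sigma>(z w := c))"
    and zZ: "\<And>w. w \<in> T \<Longrightarrow> z w \<in> Z"
    and d: "d \<in> A"
  shows "\<exists>\<sigma>\<in>(\<Pi>\<^sub>E i\<in>Z. A). \<forall>w\<in>T. Bad w \<sigma>"
proof -
  define S where "S = (\<Pi>\<^sub>E i\<in>Z. A)"
  have S: "\<sigma> \<in> S \<longleftrightarrow> (\<forall>i\<in>Z. \<sigma> i \<in> A) \<and> (\<forall>i. i \<notin> Z \<longrightarrow> \<sigma> i = undefined)" for \<sigma>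
    by (auto simp: S_def PiE_iff extensional_def)
  note local = local[folded S_def] and step = step[folded S_def]
  \<comment> \<open>The partial point with the value \<open>c w\<close> at \<open>z w\<close> for
    those \<open>w\<close> that satisfy \<open>P\<close>, and the default \<open>d\<close> elsewhere
    on \<open>Z\<close>. Distinct requirements reserve distinct coordinates, so \<open>THE\<close>
    picks the right one.\<close>
  define fill where "fill c P = (\<lambda>i. if i \<notin> Z then undefined
      else if \<exists>w. P w \<and> w \<in> T \<and> z w = i then c (THE w. w \<in> T \<and> z w = i) else d)"
    for c :: "'w \<Rightarrow> 'a" and P
  have inj: "v = w" if "v \<in> T" "w \<in> T" "z v = z w" for v w
    using that total[of v w] fresh[of v w] fresh[of w v] z[of v] z[of w] by metis
  have the: "(THE v. v \<in> T \<and> z v = z w) = w" if "w \<in> T" for w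
    using that inj by (intro the_equality) auto
  have fillS: "fill c P \<in> S" if "\<And>w. P w \<Longrightarrow> w \<in> T \<Longrightarrow> c w \<in> A" for c P
    unfolding S fill_def using that d the by auto
  \<comment> \<open>At \<open>w\<close> the values of the earlier requirements are in place and
    \<open>u\<close> is put at \<open>z w\<close>; later reserved coordinates still carry the
    default.\<close>
  define Q where "Q c w u \<longleftrightarrow> (w \<in> T \<longrightarrow> u \<in> A \<and> Bad w ((fill c (\<lambda>v. (v, w) \<in> R))(z w := u)))" for c w u
  have "\<exists>c. \<forall>w. Q c w (c w)"
  proof (rule dependent_wf_choice[OF wf])
    fix c c' :: "'w \<Rightarrow> 'a" and w u
    assume "\<And>v. (v, w) \<in> R \<Longrightarrow> c v = c' v"
    then have "fill c (\<lambda>v. (v, w) \<in> R) = fill c' (\<lambda>v. (v, w) \<in> R)"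
      unfolding fill_def using the by (intro ext) auto
    then show "Q c w u = Q c' w u" by (simp add: Q_def)
  next
    fix w and c :: "'w \<Rightarrow> 'a"
    assume IH: "\<And>v. (v, w) \<in> R \<Longrightarrow> Q c v (c v)"
    show "\<exists>u. Q c w u"
    proof (cases "w \<in> T")
      case True
      have "fill c (\<lambda>v. (v, w) \<in> R) \<in> S"
        using IH by (intro fillS) (auto simp: Q_def)
      then show ?thesis using step[OF True] True by (auto simp: Q_def)
    qed (simp add: Q_def)
  qed
  then obtain c where c: "\<And>w. w \<in> T \<Longrightarrow> c w \<in> A"
      "\<And>w. w \<in> T \<Longrightarrow> Bad w ((fill c (\<lambda>v. (v, w) \<in> R))(z w := c w))"
    unfolding Q_def by blast
  let ?\<sigma> = "fill c (\<lambda>_. True)"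
  \<comment> \<open>The final point differs from the point at \<open>w\<close> only at coordinates
    reserved by later requirements, and these lie outside \<open>V w\<close>.\<close>
  have "Bad w ?\<sigma>" if w: "w \<in> T" for w
  proof (rule local[OF w _ _ _ c(2)[OF w]])
    have "fill c (\<lambda>v. (v, w) \<in> R) \<in> S" using c(1) by (intro fillS)
    then show "(fill c (\<lambda>v. (v, w) \<in> R))(z w := c w) \<in> S"
      using c(1)[OF w] zZ[OF w] unfolding S by auto
    show "?\<sigma> \<in> S" using c(1) by (intro fillS)
    fix i assume i: "i \<in> V w"
    show "((fill c (\<lambda>v. (v, w) \<in> R))(z w := c w)) i = ?\<sigma> i"
    proof (cases "\<exists>v\<in>T. z v = i")
      case True
      then obtain v where v: "v \<in> T" "z v = i" by blast
      show ?thesis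
      proof (cases "v = w")
        case True
        then show ?thesis using v the zZ by (auto simp: fill_def)
      next
        case False
        have "(w, v) \<notin> R" using fresh[OF w v(1)] i v(2) by blast
        then have "(v, w) \<in> R" using total[OF v(1) w False] by blast
        then show ?thesis using v the[OF v(1)] inj[OF v(1) w] False by (auto simp: fill_def)
      qed
    next
      case False
      then show ?thesis using w by (auto simp: fill_def)
    qed
  qed
  then show ?thesis using c(1) unfolding S_def[symmetric] by (intro bexI[of _ ?\<sigma>] fillS) auto
qed

section \<open>Homomorphisms of quotients\<close>

locale algebra_congruence =
  fixes M :: "('i, 'a) ualg" and R :: "'a rel"
  assumes algebra: "universal_algebra M"
    and equiv: "equiv (ucarrier M) R"
    and compatible: "\<And>s xs ys. s \<in> usyms M \<Longrightarrow> xs \<in> uargs M s \<Longrightarrow> list_all2 (\<lambda>x y. (x, y) \<in> R) xs ys \<Longrightarrow>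
      (uop M s xs, uop M s ys) \<in> R"
begin

lemma uop_carrier: "s \<in> usyms M \<Longrightarrow> xs \<in> uargs M s \<Longrightarrow> uop M s xs \<in> ucarrier M"
  using algebra by (auto simp: universal_algebra_def)

lemma listset_classes: "listset (map (\<lambda>x. R `` {x}) xs) = {ys. list_all2 (\<lambda>x y. (x, y) \<in> R) xs ys}"
  by (induction xs) (auto simp: set_Cons_def list_all2_Cons1)

lemma uop_uquot:
  assumes "s \<in> usyms M" "xs \<in> uargs M s"
  shows "uop (uquot M R) s (map (\<lambda>x. R `` {x}) xs) = R `` {uop M s xs}"
proof -
  let ?rel = "list_all2 (\<lambda>x y. (x, y) \<in> R) xs"
  have eq: "R `` {uop M s ys} = R `` {uop M s xs}" if "?rel ys" for ys
    using compatible[OF assms that] equiv_class_eq[OF equiv] by metis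
  have "?rel xs"
    using assms(2) equiv by (auto simp: list_all2_same uargs_def equiv_def refl_on_def)
  \<comment> \<open>The union that defines the operation collapses to one class only over a nonempty
    set of representatives.\<close>
  then have "Collect ?rel \<noteq> {}" by blast
  moreover have "(\<Union>ys\<in>Collect ?rel. R `` {uop M s ys}) = (\<Union>ys\<in>Collect ?rel. R `` {uop M s xs})"
    by (rule SUP_cong[OF refl]) (rule eq, simp)
  ultimately have "(\<Union>ys\<in>Collect ?rel. R `` {uop M s ys}) = R `` {uop M s xs}"
    by (simp only: UN_constant if_False)
  then show ?thesis
    unfolding uquot_def by (simp add: listset_classes)
qed

lemma classes_of_args:
  assumes "Cs \<in> uargs (uquot M R) s"
  obtains xs where "xs \<in> uargs M s" "Cs = map (\<lambda>x. R `` {x}) xs"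
proof -
  have len: "length Cs = uarity M s" and "set Cs \<subseteq> ucarrier M // R"
    using assms by (auto simp: uargs_def uquot_def)
  then have "\<forall>C\<in>set Cs. \<exists>x\<in>ucarrier M. C = R `` {x}" by (auto simp: quotient_def)
  then obtain h where h: "\<And>C. C \<in> set Cs \<Longrightarrow> h C \<in> ucarrier M \<and> C = R `` {h C}" by metis
  show thesis
  proof (rule that[of "map h Cs"])
    show "map h Cs \<in> uargs M s" using h len by (auto simp: uargs_def)
    show "Cs = map (\<lambda>x. R `` {x}) (map h Cs)" using h by (simp add: map_idI[symmetric])
  qed
qed

text \<open>A relation replaces a function because a limit is determined only up to
  \<open>R\<close>. By \<open>cong\<close> the values of one class lie in one class, and by
  \<open>ext\<close> they fill it, so \<open>H\<close> sends classes to classes as sets. It is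
  applied to the limit along the stages and to a reindexing of the coordinates.\<close>

lemma uhom_of_relation:
  fixes L :: "'a \<Rightarrow> 'a \<Rightarrow> bool"
  defines "H \<equiv> \<lambda>C. {y. \<exists>x\<in>C. L x y}"
  assumes total: "\<And>x. x \<in> ucarrier M \<Longrightarrow> \<exists>y. L x y"
    and carrier: "\<And>x y. L x y \<Longrightarrow> y \<in> ucarrier M"
    and cong: "\<And>x y x' y'. L x y \<Longrightarrow> L x' y' \<Longrightarrow> (x, x') \<in> R \<Longrightarrow> (y, y') \<in> R"
    and ext: "\<And>x y y'. L x y \<Longrightarrow> (y, y') \<in> R \<Longrightarrow> L x y'"
    and ops: "\<And>s xs ys. s \<in> usyms M \<Longrightarrow> xs \<in> uargs M s \<Longrightarrow> list_all2 L xs ys \<Longrightarrow> L (uop M s xs) (uop M s ys)"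
  shows "H \<in> uhom (uquot M R) (uquot M R) \<and> (\<forall>x\<in>ucarrier M. \<forall>y. L x y \<longrightarrow> H (R `` {x}) = R `` {y})"
proof -
  have refl: "(x, x) \<in> R" if "x \<in> ucarrier M" for x
    using that equiv by (auto simp: equiv_def refl_on_def)
  have H: "H (R `` {x}) = R `` {y}" if "x \<in> ucarrier M" "L x y" for x y
    using that cong ext refl unfolding H_def by blast
  have "H \<in> uhom (uquot M R) (uquot M R)"
    unfolding uhom_def
  proof (intro CollectI conjI ballI Pi_I)
    fix C assume "C \<in> ucarrier (uquot M R)"
    then obtain x where x: "x \<in> ucarrier M" "C = R `` {x}" by (auto simp: uquot_def quotient_def)
    then obtain y where "L x y" using total by blast
    then show "H C \<in> ucarrier (uquot M R)" using H x carrier by (auto simp: uquot_def quotient_def)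
  next
    fix s Cs assume s: "s \<in> usyms (uquot M R)" and Cs: "Cs \<in> uargs (uquot M R) s"
    have sM: "s \<in> usyms M" using s by (simp add: uquot_def)
    obtain xs where xs: "xs \<in> uargs M s" "Cs = map (\<lambda>x. R `` {x}) xs"
      by (rule classes_of_args[OF Cs])
    obtain h where h: "\<And>x. x \<in> ucarrier M \<Longrightarrow> L x (h x)" using total by metis
    have xsM: "set xs \<subseteq> ucarrier M" using xs(1) by (simp add: uargs_def)
    have L: "list_all2 L xs (map h xs)"
      using xsM h by (auto simp: list.rel_map list_all2_same)
    have "map h xs \<in> uargs M s" using xs(1) h carrier by (auto simp: uargs_def)
    moreover have "map H Cs = map (\<lambda>x. R `` {x}) (map h xs)"
      using H[OF _ h] xsM by (simp add: xs(2) subset_iff)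
    ultimately have "uop (uquot M R) s (map H Cs) = R `` {uop M s (map h xs)}"
      using uop_uquot[OF sM] by (simp del: map_map)
    moreover have "H (uop (uquot M R) s Cs) = R `` {uop M s (map h xs)}"
      using H[OF uop_carrier[OF sM xs(1)] ops[OF sM xs(1) L]] uop_uquot[OF sM xs(1)] by (simp add: xs(2))
    ultimately show "H (uop (uquot M R) s Cs) = uop (uquot M R) s (map H Cs)" by simp
  qed simp_all
  then show ?thesis using H by blast
qed

end

section \<open>Powers modulo sets of size below \<kappa>\<close>

context regular_cardinal
begin

lemma small_Un: "|A| <o \<kappa> \<Longrightarrow> |B| <o \<kappa> \<Longrightarrow> |A \<union> B| <o \<kappa>"
  using card_of_Un_ordLess_infinite_Field[OF infinite Card] .

lemma small_subset: "A \<subseteq> B \<Longrightarrow> |B| <o \<kappa> \<Longrightarrow> |A| <o \<kappa>"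
  using card_of_mono1 ordLeq_ordLess_trans by blast

lemma small_empty: "|{}| <o \<kappa>"
proof -
  obtain b where "b \<in> Field \<kappa>" using infinite by fastforce
  then show ?thesis using bounded_small small_subset by (metis empty_subsetI card_of_empty ordLeq_ordLess_trans)
qed

lemma small_finite_UN: "finite I \<Longrightarrow> (\<And>i. i \<in> I \<Longrightarrow> |A i| <o \<kappa>) \<Longrightarrow> |\<Union>i\<in>I. A i| <o \<kappa>"
  by (induction I rule: finite_induct) (auto intro: small_empty small_Un)

lemma small_UN: "|I| <o \<kappa> \<Longrightarrow> (\<And>i. i \<in> I \<Longrightarrow> |A i| <o \<kappa>) \<Longrightarrow> |\<Union>i\<in>I. A i| <o \<kappa>"
  using card_of_UNION_ordLess_infinite_Field_regularCard[OF regular Cinf] by blast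

text \<open>Operations act coordinatewise and are finitary, so two results differ only on a finite
  union of the sets where corresponding arguments differ.\<close>

lemma sim_congruence:
  fixes U :: "('i, 'u) ualg"
  assumes U: "universal_algebra U"
  shows "algebra_congruence (upower U (Field \<kappa>)) (sim U \<kappa>)"
proof
  let ?P = "upower U (Field \<kappa>)"
  show "universal_algebra ?P"
    unfolding universal_algebra_def
  proof (intro ballI)
    fix s and \<sigma>s :: "('k \<Rightarrow> 'u) list" assume s: "s \<in> usyms ?P" and \<sigma>s: "\<sigma>s \<in> uargs ?P s"
    have "map (\<lambda>\<sigma>. \<sigma> \<alpha>) \<sigma>s \<in> uargs U s" if "\<alpha> \<in> Field \<kappa>" for \<alpha>
      using \<sigma>s that by (auto simp: uargs_def upower_def)
    then show "uop ?P s \<sigma>s \<in> ucarrier ?P"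
      using U s by (auto simp: universal_algebra_def upower_def)
  qed
  show "equiv (ucarrier ?P) (sim U \<kappa>)"
  proof (rule equivI)
    show "sim U \<kappa> \<subseteq> ucarrier ?P \<times> ucarrier ?P" by (auto simp: sim_def)
    show "refl_on (ucarrier ?P) (sim U \<kappa>)" using small_empty by (auto simp: refl_on_def sim_def)
    show "sym (sim U \<kappa>)"
    proof (rule symI)
      fix \<sigma> \<tau> assume "(\<sigma>, \<tau>) \<in> sim U \<kappa>"
      moreover have "{\<alpha> \<in> Field \<kappa>. \<tau> \<alpha> \<noteq> \<sigma> \<alpha>} \<subseteq> {\<alpha> \<in> Field \<kappa>. \<sigma> \<alpha> \<noteq> \<tau> \<alpha>}" by auto
      ultimately show "(\<tau>, \<sigma>) \<in> sim U \<kappa>"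
        unfolding sim_def using small_subset by blast
    qed
    show "trans (sim U \<kappa>)"
    proof (rule transI)
      fix \<rho> \<sigma> \<tau> assume "(\<rho>, \<sigma>) \<in> sim U \<kappa>" "(\<sigma>, \<tau>) \<in> sim U \<kappa>"
      moreover have "{\<alpha> \<in> Field \<kappa>. \<rho> \<alpha> \<noteq> \<tau> \<alpha>} \<subseteq> {\<alpha> \<in> Field \<kappa>. \<rho> \<alpha> \<noteq> \<sigma> \<alpha>} \<union> {\<alpha> \<in> Field \<kappa>. \<sigma> \<alpha> \<noteq> \<tau> \<alpha>}" by auto
      ultimately show "(\<rho>, \<tau>) \<in> sim U \<kappa>"
        unfolding sim_def using small_Un small_subset by blast
    qed
  qed
  fix s and \<sigma>s \<tau>s :: "('k \<Rightarrow> 'u) list"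
  assume s: "s \<in> usyms ?P" and \<sigma>s: "\<sigma>s \<in> uargs ?P s" and rel: "list_all2 (\<lambda>x y. (x, y) \<in> sim U \<kappa>) \<sigma>s \<tau>s"
  have \<tau>s: "\<tau>s \<in> uargs ?P s"
    using rel \<sigma>s unfolding uargs_def list_all2_conv_all_nth by (auto simp: sim_def in_set_conv_nth)
  have op: "uop ?P s xs \<in> ucarrier ?P" if "xs \<in> uargs ?P s" for xs
    using \<open>universal_algebra ?P\<close> s that by (auto simp: universal_algebra_def)
  let ?A = "\<lambda>i. {\<alpha> \<in> Field \<kappa>. (\<sigma>s ! i) \<alpha> \<noteq> (\<tau>s ! i) \<alpha>}"
  have "{\<alpha> \<in> Field \<kappa>. uop ?P s \<sigma>s \<alpha> \<noteq> uop ?P s \<tau>s \<alpha>} \<subseteq> (\<Union>i\<in>{..<length \<sigma>s}. ?A i)"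
  proof
    fix \<alpha> assume \<alpha>: "\<alpha> \<in> {\<alpha> \<in> Field \<kappa>. uop ?P s \<sigma>s \<alpha> \<noteq> uop ?P s \<tau>s \<alpha>}"
    then have "map (\<lambda>\<sigma>. \<sigma> \<alpha>) \<sigma>s \<noteq> map (\<lambda>\<sigma>. \<sigma> \<alpha>) \<tau>s" by (auto simp: upower_def)
    then obtain i where "i < length \<sigma>s" "(\<sigma>s ! i) \<alpha> \<noteq> (\<tau>s ! i) \<alpha>"
      using list_all2_lengthD[OF rel] by (auto simp: list_eq_iff_nth_eq)
    then show "\<alpha> \<in> (\<Union>i\<in>{..<length \<sigma>s}. ?A i)" using \<alpha> by auto
  qed
  moreover have "|\<Union>i\<in>{..<length \<sigma>s}. ?A i| <o \<kappa>"
    using rel by (intro small_finite_UN) (auto simp: list_all2_conv_all_nth sim_def)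
  ultimately show "(uop ?P s \<sigma>s, uop ?P s \<tau>s) \<in> sim U \<kappa>"
    unfolding sim_def using small_subset op \<sigma>s \<tau>s by blast
qed

text \<open>Composition with an index map, restricted to \<open>Field \<kappa>\<close> so as to stay
  in the extensional product that carries the power.\<close>

definition pull :: "('k \<Rightarrow> 'u) \<Rightarrow> ('k \<Rightarrow> 'k) \<Rightarrow> 'k \<Rightarrow> 'u" where
  "pull \<sigma> \<theta> = (\<lambda>\<alpha>\<in>Field \<kappa>. \<sigma> (\<theta> \<alpha>))"

lemma pull_carrier:
  assumes "\<sigma> \<in> ucarrier (upower U (Field \<kappa>))" "\<And>\<alpha>. \<alpha> \<in> Field \<kappa> \<Longrightarrow> \<theta> \<alpha> \<in> Field \<kappa>"
  shows "pull \<sigma> \<theta> \<in> ucarrier (upower U (Field \<kappa>))"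
  using assms by (auto simp: upower_def pull_def)

lemma pull_uop:
  assumes "\<And>\<alpha>. \<alpha> \<in> Field \<kappa> \<Longrightarrow> \<theta> \<alpha> \<in> Field \<kappa>"
  shows "pull (uop (upower U (Field \<kappa>)) s \<sigma>s) \<theta> = uop (upower U (Field \<kappa>)) s (map (\<lambda>\<sigma>. pull \<sigma> \<theta>) \<sigma>s)"
  using assms by (auto simp: upower_def pull_def o_def restrict_def)

lemma pull_sim:
  assumes "(\<sigma>, \<tau>) \<in> sim U \<kappa>" "\<And>\<alpha>. \<alpha> \<in> Field \<kappa> \<Longrightarrow> \<theta> \<alpha> \<in> Field \<kappa>"
    and "\<And>S. S \<subseteq> Field \<kappa> \<Longrightarrow> |S| <o \<kappa> \<Longrightarrow> |{\<alpha> \<in> Field \<kappa>. \<theta> \<alpha> \<in> S}| <o \<kappa>"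
  shows "(pull \<sigma> \<theta>, pull \<tau> \<theta>) \<in> sim U \<kappa>"
proof -
  let ?S = "{\<alpha> \<in> Field \<kappa>. \<sigma> \<alpha> \<noteq> \<tau> \<alpha>}"
  have "|{\<alpha> \<in> Field \<kappa>. \<theta> \<alpha> \<in> ?S}| <o \<kappa>" using assms(1) by (intro assms(3)) (auto simp: sim_def)
  moreover have "{\<alpha> \<in> Field \<kappa>. pull \<sigma> \<theta> \<alpha> \<noteq> pull \<tau> \<theta> \<alpha>} \<subseteq> {\<alpha> \<in> Field \<kappa>. \<theta> \<alpha> \<in> ?S}"
    using assms(2) by (auto simp: pull_def)
  ultimately show ?thesis
    using assms(1,2) small_subset pull_carrier unfolding sim_def by blast
qed

text \<open>Each \<open>\<rho> \<xi>\<close> retracts the coordinates onto \<open>K\<close>. A point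
  takes fewer than \<kappa> values, so stability of its level sets makes the class of
  \<open>pull \<sigma> (\<rho> \<xi>)\<close> constant from some stage on; this limit is
  \<open>E\<close>. It is idempotent because \<open>K\<close> is fixed pointwise, and a bijection of
  all coordinates with \<open>K\<close> identifies the image with the whole quotient.\<close>

lemma projection_of_point_maps:
  fixes U :: "('i, 'u) ualg" and \<Xi> :: "'j rel" and \<rho> :: "'j \<Rightarrow> 'k \<Rightarrow> 'k" and K :: "'k set"
  assumes U: "universal_algebra U" "|ucarrier U| <o \<kappa>"
    and \<Xi>: "regular_cardinal \<Xi>" "\<kappa> <o \<Xi>"
    and K: "K \<subseteq> Field \<kappa>" "|K| =o \<kappa>"
    and range: "\<And>\<xi> \<alpha>. \<xi> \<in> Field \<Xi> \<Longrightarrow> \<alpha> \<in> Field \<kappa> \<Longrightarrow> \<rho> \<xi> \<alpha> \<in> K"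
    and fixed: "\<And>\<xi> \<alpha>. \<xi> \<in> Field \<Xi> \<Longrightarrow> \<alpha> \<in> K \<Longrightarrow> \<rho> \<xi> \<alpha> = \<alpha>"
    and preimage: "\<And>\<xi> S. \<xi> \<in> Field \<Xi> \<Longrightarrow> S \<subseteq> Field \<kappa> \<Longrightarrow> |S| <o \<kappa> \<Longrightarrow> |{\<alpha> \<in> Field \<kappa>. \<rho> \<xi> \<alpha> \<in> S}| <o \<kappa>"
    and stable: "\<And>A. A \<subseteq> Field \<kappa> \<Longrightarrow> \<exists>\<eta>\<in>Field \<Xi>. \<forall>\<xi>. (\<eta>, \<xi>) \<in> \<Xi> \<longrightarrow>
      |{\<alpha> \<in> Field \<kappa>. \<rho> \<xi> \<alpha> \<in> A \<longleftrightarrow> \<rho> \<eta> \<alpha> \<notin> A}| <o \<kappa>"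
  defines "P \<equiv> upower U (Field \<kappa>)"
  defines "Q \<equiv> uquot P (sim U \<kappa>)"
  shows "\<exists>E\<in>uhom Q Q. (\<forall>x\<in>ucarrier Q. E (E x) = E x) \<and> uisomorphic (uimage E Q Q) Q \<and>
    (\<forall>\<sigma>\<in>ucarrier P. \<exists>\<eta>\<in>Field \<Xi>. \<forall>\<xi>. (\<eta>, \<xi>) \<in> \<Xi> \<longrightarrow> E (sim U \<kappa> `` {\<sigma>}) = sim U \<kappa> `` {pull \<sigma> (\<rho> \<xi>)})"
proof -
  interpret X: regular_cardinal \<Xi> by (rule \<Xi>(1))
  define R where "R = sim U \<kappa>"
  interpret A: algebra_congruence P R unfolding P_def R_def by (rule sim_congruence[OF U(1)])
  have Q: "Q = uquot P R" by (simp add: Q_def R_def)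
  note equiv = A.equiv
  have trans: "(\<rho>, \<sigma>) \<in> R \<Longrightarrow> (\<sigma>, \<tau>) \<in> R \<Longrightarrow> (\<rho>, \<tau>) \<in> R" for \<rho> \<sigma> \<tau>
    using equiv by (meson equiv_def transE)
  have sym: "(\<sigma>, \<tau>) \<in> R \<Longrightarrow> (\<tau>, \<sigma>) \<in> R" for \<sigma> \<tau>
    using equiv by (meson equiv_def symE)
  have refl: "\<sigma> \<in> ucarrier P \<Longrightarrow> (\<sigma>, \<sigma>) \<in> R" for \<sigma>
    using equiv by (auto simp: equiv_def refl_on_def)
  have simD: "\<sigma> \<in> ucarrier P" "\<tau> \<in> ucarrier P" "|{\<alpha> \<in> Field \<kappa>. \<sigma> \<alpha> \<noteq> \<tau> \<alpha>}| <o \<kappa>" if "(\<sigma>, \<tau>) \<in> R" for \<sigma> \<tau>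
    using that by (auto simp: R_def sim_def P_def)
  have simI: "(\<sigma>, \<tau>) \<in> R" if "\<sigma> \<in> ucarrier P" "\<tau> \<in> ucarrier P" "|{\<alpha> \<in> Field \<kappa>. \<sigma> \<alpha> \<noteq> \<tau> \<alpha>}| <o \<kappa>" for \<sigma> \<tau>
    using that by (auto simp: R_def sim_def P_def)
  have \<rho>K: "\<rho> \<xi> \<alpha> \<in> Field \<kappa>" if "\<xi> \<in> Field \<Xi>" "\<alpha> \<in> Field \<kappa>" for \<xi> \<alpha>
    using range K(1) that by blast
  have pullP: "pull \<sigma> (\<rho> \<xi>) \<in> ucarrier P" if "\<xi> \<in> Field \<Xi>" "\<sigma> \<in> ucarrier P" for \<xi> \<sigma>
    using pull_carrier \<rho>K that unfolding P_def by blast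
  have pullR: "(pull \<sigma> (\<rho> \<xi>), pull \<tau> (\<rho> \<xi>)) \<in> R" if "\<xi> \<in> Field \<Xi>" "(\<sigma>, \<tau>) \<in> R" for \<xi> \<sigma> \<tau>
    using pull_sim[of \<sigma> \<tau> U "\<rho> \<xi>"] \<rho>K preimage that unfolding R_def by blast
  have above2: "\<exists>\<zeta>\<in>Field \<Xi>. (\<xi>, \<zeta>) \<in> \<Xi> \<and> (\<eta>, \<zeta>) \<in> \<Xi>" if "\<xi> \<in> Field \<Xi>" "\<eta> \<in> Field \<Xi>" for \<xi> \<eta>
    using X.ex_upper2[OF that] X.lt_iff by metis

  \<comment> \<open>The value is demanded at all late stages, not at one, so that several arguments
    can be compared at a common stage.\<close>
  define lim where "lim \<sigma> \<tau> \<longleftrightarrow> \<sigma> \<in> ucarrier P \<and> \<tau> \<in> ucarrier P \<and>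
    (\<exists>\<eta>\<in>Field \<Xi>. \<forall>\<xi>. (\<eta>, \<xi>) \<in> \<Xi> \<longrightarrow> (pull \<sigma> (\<rho> \<xi>), \<tau>) \<in> R)" for \<sigma> \<tau>
  have lim_total: "\<exists>\<eta>\<in>Field \<Xi>. \<forall>\<xi>. (\<eta>, \<xi>) \<in> \<Xi> \<longrightarrow> (pull \<sigma> (\<rho> \<xi>), pull \<sigma> (\<rho> \<eta>)) \<in> R"
    if \<sigma>: "\<sigma> \<in> ucarrier P" for \<sigma>
  proof -
    \<comment> \<open>These are the level sets of \<sigma>. Each value \<open>u\<close> has its own
      settling stage \<open>e u\<close>; there are fewer than \<kappa> values, so one \<eta> in the
      regular cardinal \<Xi> lies above all these stages.\<close>
    define A where "A u = {\<alpha> \<in> Field \<kappa>. \<sigma> \<alpha> = u}" for u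
    define D where "D \<xi> \<eta> u = {\<alpha> \<in> Field \<kappa>. \<rho> \<xi> \<alpha> \<in> A u \<longleftrightarrow> \<rho> \<eta> \<alpha> \<notin> A u}" for \<xi> \<eta> u
    have "\<exists>\<eta>\<in>Field \<Xi>. \<forall>\<xi>. (\<eta>, \<xi>) \<in> \<Xi> \<longrightarrow> |D \<xi> \<eta> u| <o \<kappa>" for u
      unfolding D_def by (rule stable) (auto simp: A_def)
    then obtain e where e: "\<And>u. e u \<in> Field \<Xi>" "\<And>u \<xi>. (e u, \<xi>) \<in> \<Xi> \<Longrightarrow> |D \<xi> (e u) u| <o \<kappa>" by metis
    have "|ucarrier U| <o \<Xi>" using U(2) \<Xi>(2) ordLess_transitive by blast
    moreover have "e ` ucarrier U \<subseteq> Field \<Xi>" using e(1) by blast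
    ultimately obtain \<eta> where \<eta>: "\<eta> \<in> Field \<Xi>" "\<And>u. u \<in> ucarrier U \<Longrightarrow> e u \<in> underS \<Xi> \<eta>"
      using X.image_bounded by metis
    have "(pull \<sigma> (\<rho> \<xi>), pull \<sigma> (\<rho> \<eta>)) \<in> R" if \<xi>: "(\<eta>, \<xi>) \<in> \<Xi>" for \<xi>
    proof (rule simI)
      have \<xi>X: "\<xi> \<in> Field \<Xi>" using \<xi> X.le_Field by blast
      show "pull \<sigma> (\<rho> \<xi>) \<in> ucarrier P" "pull \<sigma> (\<rho> \<eta>) \<in> ucarrier P" using pullP \<sigma> \<eta>(1) \<xi>X by auto
      have "|D \<xi> (e u) u \<union> D \<eta> (e u) u| <o \<kappa>" if "u \<in> ucarrier U" for u
        using \<eta>(2)[OF that] \<xi> X.lt_iff X.le_trans by (intro small_Un e(2)) blast+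
      then have "|\<Union>u\<in>ucarrier U. D \<xi> (e u) u \<union> D \<eta> (e u) u| <o \<kappa>"
        by (intro small_UN[OF U(2)])
      \<comment> \<open>For \<open>u = \<sigma> (\<rho> \<xi> \<alpha>)\<close> just one of
        \<open>\<rho> \<xi> \<alpha>\<close> and \<open>\<rho> \<eta> \<alpha>\<close> lies in
        \<open>A u\<close>, so one of them disagrees there with
        \<open>\<rho> (e u) \<alpha>\<close>.\<close>
      moreover have "{\<alpha> \<in> Field \<kappa>. pull \<sigma> (\<rho> \<xi>) \<alpha> \<noteq> pull \<sigma> (\<rho> \<eta>) \<alpha>} \<subseteq> (\<Union>u\<in>ucarrier U. D \<xi> (e u) u \<union> D \<eta> (e u) u)"
      proof
        fix \<alpha> assume \<alpha>: "\<alpha> \<in> {\<alpha> \<in> Field \<kappa>. pull \<sigma> (\<rho> \<xi>) \<alpha> \<noteq> pull \<sigma> (\<rho> \<eta>) \<alpha>}"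
        then have "\<sigma> (\<rho> \<xi> \<alpha>) \<noteq> \<sigma> (\<rho> \<eta> \<alpha>)" "\<rho> \<xi> \<alpha> \<in> Field \<kappa>" "\<rho> \<eta> \<alpha> \<in> Field \<kappa>"
          using \<rho>K \<xi>X \<eta>(1) by (auto simp: pull_def)
        moreover have "\<sigma> (\<rho> \<xi> \<alpha>) \<in> ucarrier U" using \<sigma> calculation by (auto simp: P_def upower_def)
        ultimately show "\<alpha> \<in> (\<Union>u\<in>ucarrier U. D \<xi> (e u) u \<union> D \<eta> (e u) u)"
          using \<alpha> by (intro UN_I[of "\<sigma> (\<rho> \<xi> \<alpha>)"]) (auto simp: D_def A_def)
      qed
      ultimately show "|{\<alpha> \<in> Field \<kappa>. pull \<sigma> (\<rho> \<xi>) \<alpha> \<noteq> pull \<sigma> (\<rho> \<eta>) \<alpha>}| <o \<kappa>"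
        using small_subset by blast
    qed
    then show ?thesis using \<eta>(1) by blast
  qed
  \<comment> \<open>Arities are finite, so the arguments of an operation share a stage from which
    all of them have settled.\<close>
  have lim_list: "\<exists>\<eta>\<in>Field \<Xi>. \<forall>\<xi>. (\<eta>, \<xi>) \<in> \<Xi> \<longrightarrow> list_all2 (\<lambda>\<sigma> \<tau>. (pull \<sigma> (\<rho> \<xi>), \<tau>) \<in> R) \<sigma>s \<tau>s"
    if "list_all2 lim \<sigma>s \<tau>s" for \<sigma>s \<tau>s
    using that
  proof (induction rule: list_all2_induct)
    case Nil
    obtain \<eta> where "\<eta> \<in> Field \<Xi>" using X.infinite by fastforce
    then show ?case by auto
  next
    case (Cons \<sigma> \<sigma>s \<tau> \<tau>s)
    obtain \<eta>\<^sub>1 \<eta>\<^sub>2 where *: "\<eta>\<^sub>1 \<in> Field \<Xi>" "\<eta>\<^sub>2 \<in> Field \<Xi>" "\<And>\<xi>. (\<eta>\<^sub>1, \<xi>) \<in> \<Xi> \<Longrightarrow> (pull \<sigma> (\<rho> \<xi>), \<tau>) \<in> R"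
        "\<And>\<xi>. (\<eta>\<^sub>2, \<xi>) \<in> \<Xi> \<Longrightarrow> list_all2 (\<lambda>\<sigma> \<tau>. (pull \<sigma> (\<rho> \<xi>), \<tau>) \<in> R) \<sigma>s \<tau>s"
      using Cons unfolding lim_def by blast
    obtain \<eta> where "\<eta> \<in> Field \<Xi>" "(\<eta>\<^sub>1, \<eta>) \<in> \<Xi>" "(\<eta>\<^sub>2, \<eta>) \<in> \<Xi>" using above2[OF *(1,2)] by blast
    then show ?case using *(3,4) X.le_trans by (metis list_all2_Cons)
  qed

  define E where "E = (\<lambda>C. {\<tau>. \<exists>\<sigma>\<in>C. lim \<sigma> \<tau>})"
  have "E \<in> uhom Q Q \<and> (\<forall>\<sigma>\<in>ucarrier P. \<forall>\<tau>. lim \<sigma> \<tau> \<longrightarrow> E (R `` {\<sigma>}) = R `` {\<tau>})"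
    unfolding Q E_def
  proof (rule A.uhom_of_relation)
    show "\<exists>\<tau>. lim \<sigma> \<tau>" if "\<sigma> \<in> ucarrier P" for \<sigma>
      using lim_total[OF that] pullP that unfolding lim_def by blast
    show "\<tau> \<in> ucarrier P" if "lim \<sigma> \<tau>" for \<sigma> \<tau> using that by (simp add: lim_def)
    show "(\<tau>, \<tau>') \<in> R" if l: "lim \<sigma> \<tau>" "lim \<sigma>' \<tau>'" "(\<sigma>, \<sigma>') \<in> R" for \<sigma> \<tau> \<sigma>' \<tau>'
    proof -
      obtain \<eta> \<eta>' where *: "\<eta> \<in> Field \<Xi>" "\<eta>' \<in> Field \<Xi>" "\<And>\<xi>. (\<eta>, \<xi>) \<in> \<Xi> \<Longrightarrow> (pull \<sigma> (\<rho> \<xi>), \<tau>) \<in> R"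
          "\<And>\<xi>. (\<eta>', \<xi>) \<in> \<Xi> \<Longrightarrow> (pull \<sigma>' (\<rho> \<xi>), \<tau>') \<in> R"
        using l unfolding lim_def by blast
      obtain \<xi> where "\<xi> \<in> Field \<Xi>" "(\<eta>, \<xi>) \<in> \<Xi>" "(\<eta>', \<xi>) \<in> \<Xi>" using above2[OF *(1,2)] by blast
      then show ?thesis using trans[OF sym[OF *(3)] trans[OF pullR[OF _ l(3)] *(4)]] by blast
    qed
    show "lim \<sigma> \<tau>'" if "lim \<sigma> \<tau>" "(\<tau>, \<tau>') \<in> R" for \<sigma> \<tau> \<tau>'
      using that simD(2)[OF that(2)] trans[OF _ that(2)] unfolding lim_def by blast
    show "lim (uop P s \<sigma>s) (uop P s \<tau>s)"
      if s: "s \<in> usyms P" and \<sigma>s: "\<sigma>s \<in> uargs P s" and l: "list_all2 lim \<sigma>s \<tau>s" for s \<sigma>s \<tau>s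
    proof -
      have \<tau>s: "\<tau>s \<in> uargs P s"
        using l \<sigma>s unfolding uargs_def list_all2_conv_all_nth lim_def by (auto simp: in_set_conv_nth)
      obtain \<eta> where \<eta>: "\<eta> \<in> Field \<Xi>"
          "\<And>\<xi>. (\<eta>, \<xi>) \<in> \<Xi> \<Longrightarrow> list_all2 (\<lambda>\<sigma> \<tau>. (pull \<sigma> (\<rho> \<xi>), \<tau>) \<in> R) \<sigma>s \<tau>s"
        using lim_list[OF l] by blast
      have "(pull (uop P s \<sigma>s) (\<rho> \<xi>), uop P s \<tau>s) \<in> R" if \<xi>: "(\<eta>, \<xi>) \<in> \<Xi>" for \<xi>
      proof -
        have \<xi>X: "\<xi> \<in> Field \<Xi>" using \<xi> X.le_Field by blast
        have "map (\<lambda>\<sigma>. pull \<sigma> (\<rho> \<xi>)) \<sigma>s \<in> uargs P s"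
          using \<sigma>s pullP[OF \<xi>X] by (auto simp: uargs_def)
        then have "(uop P s (map (\<lambda>\<sigma>. pull \<sigma> (\<rho> \<xi>)) \<sigma>s), uop P s \<tau>s) \<in> R"
          using \<eta>(2)[OF \<xi>] by (intro A.compatible[OF s]) (simp_all add: list.rel_map)
        then show ?thesis using pull_uop[of "\<rho> \<xi>" U s \<sigma>s] \<rho>K[OF \<xi>X] by (simp add: P_def)
      qed
      then show ?thesis
        using \<eta>(1) A.uop_carrier[OF s \<sigma>s] A.uop_carrier[OF s \<tau>s] unfolding lim_def by blast
    qed
  qed
  then have E: "E \<in> uhom Q Q" and E_class: "\<And>\<sigma> \<tau>. \<sigma> \<in> ucarrier P \<Longrightarrow> lim \<sigma> \<tau> \<Longrightarrow> E (R `` {\<sigma>}) = R `` {\<tau>}"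
    by auto
  have QR: "ucarrier Q = ucarrier P // R" by (simp add: Q uquot_def)
  have E_pull: "\<exists>\<eta>\<in>Field \<Xi>. \<forall>\<xi>. (\<eta>, \<xi>) \<in> \<Xi> \<longrightarrow> E (R `` {\<sigma>}) = R `` {pull \<sigma> (\<rho> \<xi>)}"
    if \<sigma>: "\<sigma> \<in> ucarrier P" for \<sigma>
  proof -
    obtain \<eta> where \<eta>: "\<eta> \<in> Field \<Xi>" "\<And>\<xi>. (\<eta>, \<xi>) \<in> \<Xi> \<Longrightarrow> (pull \<sigma> (\<rho> \<xi>), pull \<sigma> (\<rho> \<eta>)) \<in> R"
      using lim_total[OF \<sigma>] by blast
    then have "lim \<sigma> (pull \<sigma> (\<rho> \<eta>))" using \<sigma> pullP unfolding lim_def by blast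
    then show ?thesis using E_class[OF \<sigma>] \<eta> equiv_class_eq[OF equiv] by metis
  qed
  have idem: "E (E x) = E x" if x: "x \<in> ucarrier Q" for x
  proof -
    obtain \<sigma> where \<sigma>: "\<sigma> \<in> ucarrier P" "x = R `` {\<sigma>}" using x unfolding QR by (auto simp: quotient_def)
    obtain \<eta> where \<eta>: "\<eta> \<in> Field \<Xi>" "\<And>\<xi>. (\<eta>, \<xi>) \<in> \<Xi> \<Longrightarrow> (pull \<sigma> (\<rho> \<xi>), pull \<sigma> (\<rho> \<eta>)) \<in> R"
      using lim_total[OF \<sigma>(1)] by blast
    define \<tau> where "\<tau> = pull \<sigma> (\<rho> \<eta>)"
    \<comment> \<open>\<open>\<rho> \<xi> \<alpha>\<close> already lies in \<open>K\<close>, where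
      \<open>\<rho> \<eta>\<close> is the identity. Hence \<tau> is its own limit.\<close>
    have "pull \<tau> (\<rho> \<xi>) = pull \<sigma> (\<rho> \<xi>)" if "\<xi> \<in> Field \<Xi>" for \<xi>
      unfolding \<tau>_def pull_def using range[OF that] fixed[OF \<eta>(1)] \<rho>K[OF that] by (auto simp: restrict_def)
    then have "lim \<sigma> \<tau>" "lim \<tau> \<tau>"
      using \<eta> \<sigma>(1) pullP X.le_Field unfolding lim_def \<tau>_def by metis+
    then show ?thesis using E_class \<sigma> unfolding lim_def by metis
  qed

  have "|Field \<kappa>| =o |K|"
    using K(2) card_of_Field_ordIso[OF Card] ordIso_symmetric ordIso_transitive by blast
  then obtain \<theta> where \<theta>: "bij_betw \<theta> (Field \<kappa>) K" using card_of_ordIso by blast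
  have \<theta>K: "\<theta> \<alpha> \<in> K" "\<theta> \<alpha> \<in> Field \<kappa>" if "\<alpha> \<in> Field \<kappa>" for \<alpha>
    using \<theta> K(1) that by (auto simp: bij_betw_def)
  have pull\<theta>P: "pull \<sigma> \<theta> \<in> ucarrier P" if "\<sigma> \<in> ucarrier P" for \<sigma>
    using pull_carrier \<theta>K that unfolding P_def by blast
  have \<theta>_preimage: "|{\<alpha> \<in> Field \<kappa>. \<theta> \<alpha> \<in> S}| <o \<kappa>" if "|S| <o \<kappa>" for S
  proof -
    have "inj_on \<theta> {\<alpha> \<in> Field \<kappa>. \<theta> \<alpha> \<in> S}" using \<theta> by (auto simp: bij_betw_def inj_on_def)
    moreover have "\<theta> ` {\<alpha> \<in> Field \<kappa>. \<theta> \<alpha> \<in> S} \<subseteq> S" by auto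
    ultimately have "|{\<alpha> \<in> Field \<kappa>. \<theta> \<alpha> \<in> S}| \<le>o |S|" using card_of_ordLeq by blast
    then show ?thesis using that ordLeq_ordLess_trans by blast
  qed
  have pull\<theta>R: "(pull \<sigma> \<theta>, pull \<tau> \<theta>) \<in> R" if "(\<sigma>, \<tau>) \<in> R" for \<sigma> \<tau>
    using pull_sim[of \<sigma> \<tau> U \<theta>] \<theta>K \<theta>_preimage that unfolding R_def by blast
  \<comment> \<open>Reindexing along the bijection \<theta> of all coordinates with
    \<open>K\<close>; the induced \<open>H\<close>, restricted to the image of \<open>E\<close>, is
    the isomorphism sought.\<close>
  define l where "l \<sigma> \<tau> \<longleftrightarrow> \<sigma> \<in> ucarrier P \<and> (pull \<sigma> \<theta>, \<tau>) \<in> R" for \<sigma> \<tau>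
  define H where "H = (\<lambda>C. {\<tau>. \<exists>\<sigma>\<in>C. l \<sigma> \<tau>})"
  have "H \<in> uhom Q Q \<and> (\<forall>\<sigma>\<in>ucarrier P. \<forall>\<tau>. l \<sigma> \<tau> \<longrightarrow> H (R `` {\<sigma>}) = R `` {\<tau>})"
    unfolding Q H_def
  proof (rule A.uhom_of_relation)
    show "\<exists>\<tau>. l \<sigma> \<tau>" if "\<sigma> \<in> ucarrier P" for \<sigma>
      using that pull\<theta>P refl unfolding l_def by blast
    show "\<tau> \<in> ucarrier P" if "l \<sigma> \<tau>" for \<sigma> \<tau> using that simD(2) unfolding l_def by blast
    show "(\<tau>, \<tau>') \<in> R" if "l \<sigma> \<tau>" "l \<sigma>' \<tau>'" "(\<sigma>, \<sigma>') \<in> R" for \<sigma> \<tau> \<sigma>' \<tau>'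
      using trans[OF sym trans[OF pull\<theta>R[OF that(3)]]] that(1,2) unfolding l_def by blast
    show "l \<sigma> \<tau>'" if "l \<sigma> \<tau>" "(\<tau>, \<tau>') \<in> R" for \<sigma> \<tau> \<tau>'
      using that(1) trans[OF _ that(2)] unfolding l_def by blast
    show "l (uop P s \<sigma>s) (uop P s \<tau>s)"
      if s: "s \<in> usyms P" and \<sigma>s: "\<sigma>s \<in> uargs P s" and ll: "list_all2 l \<sigma>s \<tau>s" for s \<sigma>s \<tau>s
    proof -
      have "map (\<lambda>\<sigma>. pull \<sigma> \<theta>) \<sigma>s \<in> uargs P s" using \<sigma>s pull\<theta>P by (auto simp: uargs_def)
      moreover have "list_all2 (\<lambda>\<sigma> \<tau>. (\<sigma>, \<tau>) \<in> R) (map (\<lambda>\<sigma>. pull \<sigma> \<theta>) \<sigma>s) \<tau>s"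
        using ll unfolding l_def by (auto simp: list.rel_map elim: list_all2_mono)
      ultimately have "(uop P s (map (\<lambda>\<sigma>. pull \<sigma> \<theta>) \<sigma>s), uop P s \<tau>s) \<in> R"
        by (rule A.compatible[OF s])
      then show ?thesis
        using pull_uop[of \<theta> U s \<sigma>s] \<theta>K A.uop_carrier[OF s \<sigma>s] by (simp add: P_def l_def)
    qed
  qed
  then have H: "H \<in> uhom Q Q" and H_class: "\<And>\<sigma> \<tau>. \<sigma> \<in> ucarrier P \<Longrightarrow> l \<sigma> \<tau> \<Longrightarrow> H (R `` {\<sigma>}) = R `` {\<tau>}"
    by auto
  have H_pull: "H (R `` {\<sigma>}) = R `` {pull \<sigma> \<theta>}" if "\<sigma> \<in> ucarrier P" for \<sigma>
    using H_class that refl pull\<theta>P unfolding l_def by blast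
  \<comment> \<open>\<theta> takes its values in \<open>K\<close>, so the retraction
    cancels.\<close>
  have H_E: "H (R `` {pull \<sigma> (\<rho> \<xi>)}) = R `` {pull \<sigma> \<theta>}" if "\<sigma> \<in> ucarrier P" "\<xi> \<in> Field \<Xi>" for \<sigma> \<xi>
  proof -
    have "pull (pull \<sigma> (\<rho> \<xi>)) \<theta> = pull \<sigma> \<theta>"
      using fixed[OF that(2)] \<theta>K by (auto simp: pull_def restrict_def)
    then show ?thesis using H_pull[OF pullP[OF that(2,1)]] by simp
  qed
  have EQ: "E ` ucarrier Q \<subseteq> ucarrier Q" using E by (auto simp: uhom_def)
  have "inj_on H (E ` ucarrier Q)"
  proof (rule inj_onI)
    fix x x' assume "x \<in> E ` ucarrier Q" "x' \<in> E ` ucarrier Q" and Hx: "H x = H x'"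
    then obtain \<sigma> \<sigma>' where \<sigma>: "\<sigma> \<in> ucarrier P" "\<sigma>' \<in> ucarrier P" "x = E (R `` {\<sigma>})" "x' = E (R `` {\<sigma>'})"
      unfolding QR by (auto simp: quotient_def)
    obtain \<eta> \<eta>' where *: "\<eta> \<in> Field \<Xi>" "\<eta>' \<in> Field \<Xi>" "\<And>\<xi>. (\<eta>, \<xi>) \<in> \<Xi> \<Longrightarrow> x = R `` {pull \<sigma> (\<rho> \<xi>)}"
        "\<And>\<xi>. (\<eta>', \<xi>) \<in> \<Xi> \<Longrightarrow> x' = R `` {pull \<sigma>' (\<rho> \<xi>)}"
      using E_pull[OF \<sigma>(1)] E_pull[OF \<sigma>(2)] \<sigma>(3,4) by metis
    obtain \<xi> where \<xi>: "\<xi> \<in> Field \<Xi>" "(\<eta>, \<xi>) \<in> \<Xi>" "(\<eta>', \<xi>) \<in> \<Xi>" using above2[OF *(1,2)] by blast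
    have x: "x = R `` {pull \<sigma> (\<rho> \<xi>)}" "x' = R `` {pull \<sigma>' (\<rho> \<xi>)}" using *(3,4) \<xi> by auto
    have "R `` {pull \<sigma> \<theta>} = R `` {pull \<sigma>' \<theta>}" using Hx H_E \<sigma>(1,2) \<xi>(1) x by simp
    then have "(pull \<sigma> \<theta>, pull \<sigma>' \<theta>) \<in> R"
      using eq_equiv_class[OF _ equiv] pull\<theta>P \<sigma>(2) by blast
    note small = simD(3)[OF this]
    let ?D = "{\<alpha> \<in> Field \<kappa>. pull \<sigma> \<theta> \<alpha> \<noteq> pull \<sigma>' \<theta> \<alpha>}"
    have "|\<theta> ` ?D| <o \<kappa>" using small card_of_image ordLeq_ordLess_trans by blast
    moreover have "\<theta> ` ?D \<subseteq> Field \<kappa>" using \<theta>K(2) by auto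
    ultimately have "|{\<alpha> \<in> Field \<kappa>. \<rho> \<xi> \<alpha> \<in> \<theta> ` ?D}| <o \<kappa>" using preimage \<xi>(1) by blast
    \<comment> \<open>Each \<open>\<rho> \<xi> \<alpha>\<close> lies in \<open>K\<close> and so is
      some \<open>\<theta> \<beta>\<close>; a disagreement at \<alpha> puts \<beta> into the small
      set \<open>?D\<close>.\<close>
    moreover have "{\<alpha> \<in> Field \<kappa>. pull \<sigma> (\<rho> \<xi>) \<alpha> \<noteq> pull \<sigma>' (\<rho> \<xi>) \<alpha>} \<subseteq> {\<alpha> \<in> Field \<kappa>. \<rho> \<xi> \<alpha> \<in> \<theta> ` ?D}"
    proof
      fix \<alpha> assume \<alpha>: "\<alpha> \<in> {\<alpha> \<in> Field \<kappa>. pull \<sigma> (\<rho> \<xi>) \<alpha> \<noteq> pull \<sigma>' (\<rho> \<xi>) \<alpha>}"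
      then obtain \<beta> where \<beta>: "\<beta> \<in> Field \<kappa>" "\<rho> \<xi> \<alpha> = \<theta> \<beta>"
        using range[OF \<xi>(1), of \<alpha>] \<theta> by (auto simp: bij_betw_def)
      then show "\<alpha> \<in> {\<alpha> \<in> Field \<kappa>. \<rho> \<xi> \<alpha> \<in> \<theta> ` ?D}" using \<alpha> by (auto simp: pull_def)
    qed
    ultimately have "(pull \<sigma> (\<rho> \<xi>), pull \<sigma>' (\<rho> \<xi>)) \<in> R"
      using simI pullP \<xi>(1) \<sigma>(1,2) small_subset by blast
    then show "x = x'" using x equiv_class_eq[OF equiv] by metis
  qed
  moreover have "H ` E ` ucarrier Q = ucarrier Q"
  proof
    show "H ` E ` ucarrier Q \<subseteq> ucarrier Q" using EQ H by (auto simp: uhom_def)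
    show "ucarrier Q \<subseteq> H ` E ` ucarrier Q"
    proof
      fix y assume "y \<in> ucarrier Q"
      then obtain \<tau> where \<tau>: "\<tau> \<in> ucarrier P" "y = R `` {\<tau>}" unfolding QR by (auto simp: quotient_def)
      \<comment> \<open>\<tau> is carried to \<open>K\<close> by the inverse of \<theta>. The values
        off \<open>K\<close> are immaterial, since \<theta> never reads them.\<close>
      define \<sigma> where "\<sigma> = (\<lambda>\<alpha>\<in>Field \<kappa>. \<tau> (if \<alpha> \<in> K then inv_into (Field \<kappa>) \<theta> \<alpha> else \<alpha>))"
      have inv: "inv_into (Field \<kappa>) \<theta> \<alpha> \<in> Field \<kappa>" if "\<alpha> \<in> K" for \<alpha>
        using \<theta> that by (metis bij_betw_def inv_into_into)
      have \<sigma>: "\<sigma> \<in> ucarrier P" using \<tau>(1) inv by (auto simp: P_def upower_def \<sigma>_def PiE_iff)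
      have "pull \<sigma> \<theta> \<alpha> = \<tau> \<alpha>" for \<alpha>
      proof (cases "\<alpha> \<in> Field \<kappa>")
        case True
        then show ?thesis using \<theta>K[OF True] \<theta> by (simp add: pull_def \<sigma>_def bij_betw_def)
      next
        case False
        then show ?thesis using \<tau>(1) by (simp add: pull_def P_def upower_def PiE_iff extensional_def)
      qed
      then have "pull \<sigma> \<theta> = \<tau>" by blast
      moreover obtain \<xi> where "\<xi> \<in> Field \<Xi>" "E (R `` {\<sigma>}) = R `` {pull \<sigma> (\<rho> \<xi>)}"
        using E_pull[OF \<sigma>] X.le_refl by blast
      ultimately have "y = H (E (R `` {\<sigma>}))" using H_E[OF \<sigma>] \<tau>(2) by simp
      moreover have "R `` {\<sigma>} \<in> ucarrier Q" using \<sigma> unfolding QR by (auto simp: quotient_def)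
      ultimately show "y \<in> H ` E ` ucarrier Q" by blast
    qed
  qed
  ultimately have "bij_betw H (ucarrier (uimage E Q Q)) (ucarrier Q)"
    by (simp add: bij_betw_def uimage_def)
  moreover have "H \<in> uhom (uimage E Q Q) Q"
    using H EQ unfolding uhom_def uimage_def uargs_def by auto
  ultimately have "uisomorphic (uimage E Q Q) Q" unfolding uisomorphic_def by blast
  then show ?thesis using E idem E_pull unfolding R_def by blast
qed

end

section \<open>Coherent maps of blocks\<close>

text \<open>This isolates what the construction takes from \<open>dagger\<close>. \<Xi> indexes the
  stages, \<open>F x\<close> is a regular block longer than \<open>x\<close>, and
  \<open>G \<eta> x\<close> holds the subsets of the block that the \<eta>-th member of a dominating
  family catches. \<open>twins\<close> packages the counting of types, \<open>singletons\<close> the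
  fact that \<open>G \<xi> x\<close> is smaller than the block, and \<open>captured\<close> is
  domination.\<close>

locale block_system = regular_cardinal \<kappa> for \<kappa> :: "'k rel" +
  fixes \<Xi> :: "'j rel" and F :: "'k \<Rightarrow> 'k set" and G :: "'j \<Rightarrow> 'k \<Rightarrow> 'k set set"
  assumes stages: "regular_cardinal \<Xi>" "\<kappa> <o \<Xi>"
    and stages_below: "\<And>\<xi>. \<xi> \<in> Field \<Xi> \<Longrightarrow> |underS \<Xi> \<xi>| \<le>o \<kappa>"
    and F_Field: "\<And>x. x \<in> Field \<kappa> \<Longrightarrow> F x \<subseteq> Field \<kappa>"
    and F_small: "\<And>x. x \<in> Field \<kappa> \<Longrightarrow> |F x| <o \<kappa>"
    and F_regular: "\<And>x. x \<in> Field \<kappa> \<Longrightarrow> regular_cardinal (Restr \<kappa> (F x))"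
    and F_large: "\<And>x. x \<in> Field \<kappa> \<Longrightarrow> |underS \<kappa> x| <o Restr \<kappa> (F x)"
    and twins: "\<And>x J c. x \<in> Field \<kappa> \<Longrightarrow> J \<subseteq> Field \<Xi> \<Longrightarrow> |J| \<le>o |underS \<kappa> x| \<Longrightarrow> c \<in> F x \<Longrightarrow>
      \<exists>m\<in>F x. \<exists>b\<in>F x. c \<in> underS \<kappa> m \<and> m \<in> underS \<kappa> b \<and> (\<forall>\<eta>\<in>J. \<forall>B\<in>G \<eta> x. m \<in> B \<longleftrightarrow> b \<in> B)"
    and singletons: "\<And>x \<xi>. x \<in> Field \<kappa> \<Longrightarrow> \<xi> \<in> Field \<Xi> \<Longrightarrow> \<exists>c\<in>F x. \<forall>y\<in>F x. {y} \<in> G \<xi> x \<longrightarrow> (y, c) \<in> \<kappa>"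
    and captured: "\<And>A. \<exists>\<xi>\<in>Field \<Xi>. \<exists>\<beta>\<in>Field \<kappa>. \<forall>x\<in>Field \<kappa>. (\<beta>, x) \<in> \<kappa> \<longrightarrow> {y \<in> F x. (x, y) \<in> A} \<in> G \<xi> x"
begin

lemma Field_Restr_F: "x \<in> Field \<kappa> \<Longrightarrow> Field (Restr \<kappa> (F x)) = F x"
  by (rule Field_Restr[OF F_Field])

lemma underS_Restr_F: "x \<in> Field \<kappa> \<Longrightarrow> y \<in> F x \<Longrightarrow> underS (Restr \<kappa> (F x)) y = underS \<kappa> y \<inter> F x"
  by (auto simp: underS_def)

lemma F_bounded:
  assumes "x \<in> Field \<kappa>" "|I| \<le>o |underS \<kappa> x|" "h ` I \<subseteq> F x"
  shows "\<exists>b\<in>F x. \<forall>i\<in>I. h i \<sqsubset> b"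
proof -
  have "|I| <o Restr \<kappa> (F x)" using assms(1,2) F_large ordLeq_ordLess_trans by blast
  moreover have "h ` I \<subseteq> Field (Restr \<kappa> (F x))" using assms Field_Restr_F by simp
  ultimately obtain b where "b \<in> F x" "\<And>i. i \<in> I \<Longrightarrow> h i \<in> underS (Restr \<kappa> (F x)) b"
    using regular_cardinal.image_bounded[OF F_regular[OF assms(1)]] Field_Restr_F[OF assms(1)] by metis
  then show ?thesis using underS_Restr_F[OF assms(1)] by blast
qed

lemma F_nonempty: "x \<in> Field \<kappa> \<Longrightarrow> F x \<noteq> {}"
  using regular_cardinal.infinite[OF F_regular] Field_Restr_F by fastforce

text \<open>
  The clause on singletons makes the functions \<open>m\<close> of the stages cofinal in the product of the blocks.
\<close>

definition stage :: "'j \<Rightarrow> ('k \<Rightarrow> 'k) \<times> ('k \<Rightarrow> 'k) \<times> ('k \<Rightarrow> 'k \<Rightarrow> 'k) \<Rightarrow> bool" where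
  "stage \<xi> = (\<lambda>(m, b, r). \<forall>x\<in>Field \<kappa>. m x \<in> F x \<and> b x \<in> F x \<and> m x \<sqsubset> b x \<and>
     (\<forall>y\<in>F x. r x y \<in> F x) \<and> r x (m x) = b x \<and> (\<forall>y\<in>F x. b x \<sqsubseteq> y \<longrightarrow> r x y = y) \<and>
     (\<forall>y\<in>F x. {y} \<in> G \<xi> x \<longrightarrow> y \<sqsubset> m x))"

text \<open>If \<open>(m, b, r)\<close> is a stage for \<eta>, then \<open>r x y\<close> and
  \<open>r' x y\<close> lie in the same members of \<open>G \<eta> x\<close>: they are equal below
  \<open>b x\<close>, and from there on \<open>r x y = y\<close>. This is what makes later stages
  agree with \<eta> on captured sets.\<close>

definition coherent :: "'j \<Rightarrow> ('k \<Rightarrow> 'k) \<times> ('k \<Rightarrow> 'k) \<times> ('k \<Rightarrow> 'k \<Rightarrow> 'k) \<Rightarrow>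
    ('k \<Rightarrow> 'k) \<times> ('k \<Rightarrow> 'k) \<times> ('k \<Rightarrow> 'k \<Rightarrow> 'k) \<Rightarrow> 'k \<Rightarrow> bool" where
  "coherent \<eta> = (\<lambda>(m, b, r) (m', b', r') x. b x \<sqsubseteq> b' x \<and>
     (\<forall>y\<in>F x. y \<sqsubset> b x \<longrightarrow> r' x y = r x y) \<and>
     (\<forall>y\<in>F x. b x \<sqsubseteq> y \<longrightarrow> (\<forall>B\<in>G \<eta> x. r' x y \<in> B \<longleftrightarrow> y \<in> B)))"

lemma upper2_F:
  assumes "x \<in> Field \<kappa>" "c \<in> F x" "d \<in> F x"
  obtains e where "e \<in> F x" "c \<sqsubseteq> e" "d \<sqsubseteq> e"
proof -
  have "c \<in> Field \<kappa>" "d \<in> Field \<kappa>" using F_Field[OF assms(1)] assms by auto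
  then show thesis using that assms le_refl not_lt lt_iff by metis
qed

text \<open>A block can serve at most |x| earlier stages at once: their bounds then have a common
  bound in the regular block \<open>F x\<close>, and the new move takes place above it.\<close>

lemma glue_at:
  assumes x: "x \<in> Field \<kappa>" and \<xi>: "\<xi> \<in> Field \<Xi>" and J: "J \<subseteq> Field \<Xi>" "|J| \<le>o |underS \<kappa> x|"
    and st: "\<And>\<eta>. \<eta> \<in> J \<Longrightarrow> stage \<eta> (t \<eta>)"
    and coh: "\<And>\<eta> \<zeta>. \<eta> \<in> J \<Longrightarrow> \<zeta> \<in> J \<Longrightarrow> \<eta> \<in> underS \<Xi> \<zeta> \<Longrightarrow> coherent \<eta> (t \<eta>) (t \<zeta>) x"
  shows "\<exists>m b r. m \<in> F x \<and> b \<in> F x \<and> m \<sqsubset> b \<and> (\<forall>y\<in>F x. r y \<in> F x) \<and> r m = b \<and>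
    (\<forall>y\<in>F x. b \<sqsubseteq> y \<longrightarrow> r y = y) \<and> (\<forall>y\<in>F x. {y} \<in> G \<xi> x \<longrightarrow> y \<sqsubset> m) \<and>
    (\<forall>\<eta>\<in>J. coherent \<eta> (t \<eta>) (\<lambda>_. m, \<lambda>_. b, \<lambda>_. r) x)"
proof -
  interpret X: regular_cardinal \<Xi> by (rule stages(1))
  define B where "B \<eta> = fst (snd (t \<eta>)) x" for \<eta>
  define R where "R \<eta> = snd (snd (t \<eta>)) x" for \<eta>
  have B: "B \<eta> \<in> F x" "\<And>y. y \<in> F x \<Longrightarrow> R \<eta> y \<in> F x" "\<And>y. y \<in> F x \<Longrightarrow> B \<eta> \<sqsubseteq> y \<Longrightarrow> R \<eta> y = y" if "\<eta> \<in> J" for \<eta>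
    using st[OF that] x by (auto simp: stage_def B_def R_def split: prod.splits)
  have coh': "B \<eta> \<sqsubseteq> B \<zeta>" "\<And>y. y \<in> F x \<Longrightarrow> y \<sqsubset> B \<eta> \<Longrightarrow> R \<zeta> y = R \<eta> y"
      "\<And>y C. y \<in> F x \<Longrightarrow> B \<eta> \<sqsubseteq> y \<Longrightarrow> C \<in> G \<eta> x \<Longrightarrow> R \<zeta> y \<in> C \<longleftrightarrow> y \<in> C"
    if "\<eta> \<in> J" "\<zeta> \<in> J" "\<eta> \<in> underS \<Xi> \<zeta>" for \<eta> \<zeta>
    using coh[OF that] by (auto simp: coherent_def B_def R_def split: prod.splits)
  obtain c\<^sub>1 where c1: "c\<^sub>1 \<in> F x" "\<And>\<eta>. \<eta> \<in> J \<Longrightarrow> B \<eta> \<sqsubseteq> c\<^sub>1"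
    using F_bounded[OF x J(2), of B] B(1) lt_iff by (metis image_subsetI)
  obtain c\<^sub>2 where c2: "c\<^sub>2 \<in> F x" "\<And>y. y \<in> F x \<Longrightarrow> {y} \<in> G \<xi> x \<Longrightarrow> y \<sqsubseteq> c\<^sub>2"
    using singletons[OF x \<xi>] by metis
  obtain c where c: "c \<in> F x" "c\<^sub>1 \<sqsubseteq> c" "c\<^sub>2 \<sqsubseteq> c"
    using upper2_F[OF x c1(1) c2(1)] by blast
  \<comment> \<open>Above all earlier bounds there are no values left to extend, so \<open>m\<close>
    is free to move. As \<open>m\<close> and \<open>b\<close> are twins, the move respects all sets
    of \<open>G \<eta> x\<close> for \<eta> in \<open>J\<close>; lying above
    \<open>c\<^sub>2\<close> gives the clause on singletons.\<close>
  obtain m b where mb: "m \<in> F x" "b \<in> F x" "c \<sqsubset> m" "m \<sqsubset> b"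
      "\<And>\<eta> C. \<eta> \<in> J \<Longrightarrow> C \<in> G \<eta> x \<Longrightarrow> m \<in> C \<longleftrightarrow> b \<in> C"
    using twins[OF x J c(1)] by metis
  have Bm: "B \<eta> \<sqsubset> m" if "\<eta> \<in> J" for \<eta>
    using c1(2)[OF that] c(2) mb(3) le_lt_trans by blast
  define below where "below y \<longleftrightarrow> (\<exists>\<eta>\<in>J. y \<sqsubset> B \<eta>)" for y
  define pick where "pick y = (SOME \<eta>. \<eta> \<in> J \<and> y \<sqsubset> B \<eta>)" for y
  have pick: "pick y \<in> J" "y \<sqsubset> B (pick y)" if "below y" for y
    using someI_ex[of "\<lambda>\<eta>. \<eta> \<in> J \<and> y \<sqsubset> B \<eta>"] that unfolding below_def pick_def by auto
  \<comment> \<open>The new map copies an earlier map below its bound, moves \<open>m\<close>, and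
    fixes everything else. By \<open>agree\<close> below, it does not matter which earlier stage is
    picked.\<close>
  define r where "r y = (if y = m then b else if below y then R (pick y) y else y)" for y
  have not_below_m: "\<not> below m"
    using Bm lt_trans lt_irrefl unfolding below_def by blast
  have not_below_b: "\<not> below y \<and> y \<noteq> m" if "b \<sqsubseteq> y" for y
    using Bm that mb(4) lt_trans lt_irrefl lt_le_trans unfolding below_def by blast
  have KF: "y \<in> Field \<kappa>" if "y \<in> F x" for y using F_Field[OF x] that by blast
  have agree: "R \<zeta> y = R \<eta> y" if "\<eta> \<in> J" "\<zeta> \<in> J" "y \<in> F x" "y \<sqsubset> B \<eta>" "y \<sqsubset> B \<zeta>" for \<eta> \<zeta> y
  proof (cases "\<eta> = \<zeta>")
    case False
    then have "\<eta> \<in> underS \<Xi> \<zeta> \<or> \<zeta> \<in> underS \<Xi> \<eta>" using X.lt_total that J by blast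
    then show ?thesis using that coh'(2) by metis
  qed simp
  have 1: "r y = R \<eta> y" if "\<eta> \<in> J" "y \<in> F x" "y \<sqsubset> B \<eta>" for \<eta> y
  proof -
    have "below y" using that by (auto simp: below_def)
    moreover have "y \<noteq> m" using calculation not_below_m by blast
    ultimately show ?thesis
      using agree[OF that(1) pick(1) that(2,3) pick(2)] by (simp add: r_def)
  qed
  have 2: "r y \<in> C \<longleftrightarrow> y \<in> C" if "\<eta> \<in> J" "y \<in> F x" "B \<eta> \<sqsubseteq> y" "C \<in> G \<eta> x" for \<eta> y C
  proof (cases "below y")
    case True
    let ?\<zeta> = "pick y"
    \<comment> \<open>\<open>y\<close> lies below the bound of \<open>?\<zeta>\<close> but not below
      that of \<eta>. Bounds grow along coherent stages, so \<open>?\<zeta>\<close> comes after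
      \<eta> and its map respects \<open>G \<eta> x\<close> at \<open>y\<close>.\<close>
    have "\<not> B ?\<zeta> \<sqsubseteq> B \<eta>" using pick(2)[OF True] that(3) le_trans lt_le_trans lt_irrefl by metis
    then have "?\<zeta> \<notin> underS \<Xi> \<eta>" "?\<zeta> \<noteq> \<eta>"
      using coh'(1) pick(1)[OF True] that(1) le_refl KF B(1) by metis+
    then have "\<eta> \<in> underS \<Xi> ?\<zeta>" using X.lt_total[of \<eta> ?\<zeta>] J that(1) pick(1)[OF True] by blast
    then have "R ?\<zeta> y \<in> C \<longleftrightarrow> y \<in> C" using coh'(3) that pick(1)[OF True] by blast
    then show ?thesis using True not_below_m by (auto simp: r_def)
  qed (use mb(5) that in \<open>auto simp: r_def\<close>)
  have "coherent \<eta> (t \<eta>) (\<lambda>_. m, \<lambda>_. b, \<lambda>_. r) x" if "\<eta> \<in> J" for \<eta>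
    using 1[OF that] 2[OF that] Bm[OF that] mb(4) lt_trans[of "B \<eta>" m b] lt_iff
    by (auto simp: coherent_def B_def[symmetric] R_def[symmetric] split_beta)
  moreover have "\<forall>y\<in>F x. r y \<in> F x"
    using mb(2) B(2) pick(1) by (auto simp: r_def)
  moreover have "\<forall>y\<in>F x. b \<sqsubseteq> y \<longrightarrow> r y = y"
    using not_below_b by (auto simp: r_def)
  moreover have "\<forall>y\<in>F x. {y} \<in> G \<xi> x \<longrightarrow> y \<sqsubset> m"
    using c2(2) c(3) mb(3) le_lt_trans le_trans by blast
  moreover have "r m = b" by (simp add: r_def)
  ultimately show ?thesis using mb(1,2,4) by blast
qed

text \<open>There may be \<kappa> many predecessors, while block \<open>x\<close> can serve only |x|
  of them. They are enumerated in \<kappa>, and block \<open>x\<close> serves a set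
  \<open>J x\<close> that is pairwise coherent at \<open>x\<close>. Every predecessor belongs to
  \<open>J x\<close> for all large \<open>x\<close>, and coherence is asked only in almost all
  blocks.\<close>

lemma extend_stages:
  assumes \<xi>: "\<xi> \<in> Field \<Xi>"
    and st: "\<And>\<eta>. \<eta> \<in> underS \<Xi> \<xi> \<Longrightarrow> stage \<eta> (t \<eta>)"
    and coh: "\<And>\<eta> \<zeta>. \<zeta> \<in> underS \<Xi> \<xi> \<Longrightarrow> \<eta> \<in> underS \<Xi> \<zeta> \<Longrightarrow>
      \<exists>\<beta>\<in>Field \<kappa>. \<forall>x\<in>Field \<kappa>. \<beta> \<sqsubseteq> x \<longrightarrow> coherent \<eta> (t \<eta>) (t \<zeta>) x"
  shows "\<exists>u. stage \<xi> u \<and> (\<forall>\<eta>\<in>underS \<Xi> \<xi>. \<exists>\<beta>\<in>Field \<kappa>. \<forall>x\<in>Field \<kappa>. \<beta> \<sqsubseteq> x \<longrightarrow> coherent \<eta> (t \<eta>) u x)"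
proof -
  interpret X: regular_cardinal \<Xi> by (rule stages(1))
  let ?D = "underS \<Xi> \<xi>"
  have "|?D| \<le>o |Field \<kappa>|"
    using stages_below[OF \<xi>] Card card_of_Field_ordIso ordIso_symmetric ordLeq_ordIso_trans by blast
  then obtain v where v: "inj_on v ?D" "v ` ?D \<subseteq> Field \<kappa>"
    using card_of_ordLeq[of ?D "Field \<kappa>"] by blast
  define \<beta> where "\<beta> \<eta> \<zeta> = (SOME \<beta>. \<beta> \<in> Field \<kappa> \<and> (\<forall>x\<in>Field \<kappa>. \<beta> \<sqsubseteq> x \<longrightarrow> coherent \<eta> (t \<eta>) (t \<zeta>) x))" for \<eta> \<zeta>
  have \<beta>: "\<beta> \<eta> \<zeta> \<in> Field \<kappa> \<and> (\<forall>x\<in>Field \<kappa>. \<beta> \<eta> \<zeta> \<sqsubseteq> x \<longrightarrow> coherent \<eta> (t \<eta>) (t \<zeta>) x)"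
    if "\<zeta> \<in> ?D" "\<eta> \<in> underS \<Xi> \<zeta>" for \<eta> \<zeta>
    unfolding \<beta>_def by (rule someI_ex) (use coh[OF that] in blast)
  have vK: "v \<eta> \<in> Field \<kappa>" if "\<eta> \<in> ?D" for \<eta> using v(2) that by blast
  \<comment> \<open>Fewer than \<kappa> predecessors are enumerated before \<eta>, so the thresholds
    for their coherence with \<eta> are bounded.\<close>
  have "\<exists>d\<in>Field \<kappa>. \<forall>\<zeta>\<in>?D. v \<zeta> \<sqsubset> v \<eta> \<longrightarrow>
      (\<eta> \<in> underS \<Xi> \<zeta> \<longrightarrow> \<beta> \<eta> \<zeta> \<sqsubseteq> d) \<and> (\<zeta> \<in> underS \<Xi> \<eta> \<longrightarrow> \<beta> \<zeta> \<eta> \<sqsubseteq> d)" if \<eta>: "\<eta> \<in> ?D" for \<eta>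
  proof -
    let ?S = "{\<zeta> \<in> ?D. v \<zeta> \<sqsubset> v \<eta>}"
    have "inj_on v ?S" using v(1) by (auto simp: inj_on_def)
    moreover have "v ` ?S \<subseteq> underS \<kappa> (v \<eta>)" by auto
    ultimately have "|?S| \<le>o |underS \<kappa> (v \<eta>)|" using card_of_ordLeq by blast
    then have small: "|?S| <o \<kappa>" using bounded_small[OF vK[OF \<eta>]] ordLeq_ordLess_trans by blast
    obtain a where a: "a \<in> Field \<kappa>" using vK[OF \<eta>] by blast
    define h where "h \<zeta> = (if \<eta> \<in> underS \<Xi> \<zeta> then \<beta> \<eta> \<zeta> else if \<zeta> \<in> underS \<Xi> \<eta> then \<beta> \<zeta> \<eta> else a)" for \<zeta>
    have "h ` ?S \<subseteq> Field \<kappa>" using \<beta> \<eta> a by (auto simp: h_def)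
    then obtain d where d: "d \<in> Field \<kappa>" "\<And>\<zeta>. \<zeta> \<in> ?S \<Longrightarrow> h \<zeta> \<sqsubset> d"
      by (rule image_bounded[OF small]) blast
    have "(\<eta> \<in> underS \<Xi> \<zeta> \<longrightarrow> \<beta> \<eta> \<zeta> \<sqsubseteq> d) \<and> (\<zeta> \<in> underS \<Xi> \<eta> \<longrightarrow> \<beta> \<zeta> \<eta> \<sqsubseteq> d)"
      if "\<zeta> \<in> ?D" "v \<zeta> \<sqsubset> v \<eta>" for \<zeta>
      using d(2)[of \<zeta>] that X.lt_trans[of \<eta> \<zeta> \<eta>] X.lt_irrefl lt_iff by (auto simp: h_def split: if_splits)
    then show ?thesis using d(1) by blast
  qed
  then obtain d where d: "\<And>\<eta>. \<eta> \<in> ?D \<Longrightarrow> d \<eta> \<in> Field \<kappa>"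
     "\<And>\<eta> \<zeta>. \<eta> \<in> ?D \<Longrightarrow> \<zeta> \<in> ?D \<Longrightarrow> v \<zeta> \<sqsubset> v \<eta> \<Longrightarrow> \<eta> \<in> underS \<Xi> \<zeta> \<Longrightarrow> \<beta> \<eta> \<zeta> \<sqsubseteq> d \<eta>"
     "\<And>\<eta> \<zeta>. \<eta> \<in> ?D \<Longrightarrow> \<zeta> \<in> ?D \<Longrightarrow> v \<zeta> \<sqsubset> v \<eta> \<Longrightarrow> \<zeta> \<in> underS \<Xi> \<eta> \<Longrightarrow> \<beta> \<zeta> \<eta> \<sqsubseteq> d \<eta>"
    by metis
  define J where "J x = {\<eta> \<in> ?D. v \<eta> \<sqsubset> x \<and> d \<eta> \<sqsubseteq> x}" for x
  have JD: "J x \<subseteq> ?D" for x by (auto simp: J_def)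
  have Jc: "|J x| \<le>o |underS \<kappa> x|" for x
  proof -
    have "inj_on v (J x)" using v(1) JD inj_on_subset by blast
    moreover have "v ` J x \<subseteq> underS \<kappa> x" by (auto simp: J_def)
    ultimately show ?thesis using card_of_ordLeq by blast
  qed
  have Jcoh: "coherent \<eta> (t \<eta>) (t \<zeta>) x"
    if "x \<in> Field \<kappa>" "\<eta> \<in> J x" "\<zeta> \<in> J x" "\<eta> \<in> underS \<Xi> \<zeta>" for \<eta> \<zeta> x
  proof -
    have D: "\<eta> \<in> ?D" "\<zeta> \<in> ?D" "d \<eta> \<sqsubseteq> x" "d \<zeta> \<sqsubseteq> x" using that by (auto simp: J_def)
    have "\<eta> \<noteq> \<zeta>" using that(4) X.lt_irrefl by blast
    then have "v \<eta> \<noteq> v \<zeta>" using v(1) D by (auto simp: inj_on_def)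
    \<comment> \<open>Whichever of the two is enumerated later has its \<open>d\<close> above the
      threshold of the pair.\<close>
    then have "v \<eta> \<sqsubset> v \<zeta> \<or> v \<zeta> \<sqsubset> v \<eta>" using lt_total vK D by blast
    then have "\<beta> \<eta> \<zeta> \<sqsubseteq> x" using d(2)[OF D(1,2)] d(3)[OF D(2,1)] D(3,4) that(4) le_trans by blast
    then show ?thesis using \<beta> D that by blast
  qed
  have DX: "?D \<subseteq> Field \<Xi>" using X.le_Field X.lt_iff by blast
  have "\<forall>x\<in>Field \<kappa>. \<exists>m b r. m \<in> F x \<and> b \<in> F x \<and> m \<sqsubset> b \<and> (\<forall>y\<in>F x. r y \<in> F x) \<and> r m = b \<and>
    (\<forall>y\<in>F x. b \<sqsubseteq> y \<longrightarrow> r y = y) \<and> (\<forall>y\<in>F x. {y} \<in> G \<xi> x \<longrightarrow> y \<sqsubset> m) \<and>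
    (\<forall>\<eta>\<in>J x. coherent \<eta> (t \<eta>) (\<lambda>_. m, \<lambda>_. b, \<lambda>_. r) x)"
  proof
    fix x assume x: "x \<in> Field \<kappa>"
    show "\<exists>m b r. m \<in> F x \<and> b \<in> F x \<and> m \<sqsubset> b \<and> (\<forall>y\<in>F x. r y \<in> F x) \<and> r m = b \<and>
      (\<forall>y\<in>F x. b \<sqsubseteq> y \<longrightarrow> r y = y) \<and> (\<forall>y\<in>F x. {y} \<in> G \<xi> x \<longrightarrow> y \<sqsubset> m) \<and>
      (\<forall>\<eta>\<in>J x. coherent \<eta> (t \<eta>) (\<lambda>_. m, \<lambda>_. b, \<lambda>_. r) x)"
      using JD DX st Jcoh[OF x] by (intro glue_at[OF x \<xi> _ Jc]) blast+
  qed
  then obtain m b r where mbr: "\<forall>x\<in>Field \<kappa>. m x \<in> F x \<and> b x \<in> F x \<and> m x \<sqsubset> b x \<and> (\<forall>y\<in>F x. r x y \<in> F x) \<and> r x (m x) = b x \<and>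
      (\<forall>y\<in>F x. b x \<sqsubseteq> y \<longrightarrow> r x y = y) \<and> (\<forall>y\<in>F x. {y} \<in> G \<xi> x \<longrightarrow> y \<sqsubset> m x) \<and>
      (\<forall>\<eta>\<in>J x. coherent \<eta> (t \<eta>) (\<lambda>_. m x, \<lambda>_. b x, \<lambda>_. r x) x)"
    unfolding bchoice_iff by blast
  have "stage \<xi> (m, b, r)" using mbr by (simp add: stage_def)
  moreover have "\<exists>\<beta>\<in>Field \<kappa>. \<forall>x\<in>Field \<kappa>. \<beta> \<sqsubseteq> x \<longrightarrow> coherent \<eta> (t \<eta>) (m, b, r) x" if \<eta>: "\<eta> \<in> ?D" for \<eta>
  proof -
    obtain \<gamma> where \<gamma>: "\<gamma> \<in> Field \<kappa>" "v \<eta> \<sqsubset> \<gamma>" "d \<eta> \<sqsubset> \<gamma>"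
      by (rule ex_upper2[OF vK[OF \<eta>] d(1)[OF \<eta>]])
    have "coherent \<eta> (t \<eta>) (m, b, r) x" if x: "x \<in> Field \<kappa>" "\<gamma> \<sqsubseteq> x" for x
    proof -
      have "\<eta> \<in> J x" using \<eta> lt_le_trans[OF \<gamma>(2) x(2)] lt_le_trans[OF \<gamma>(3) x(2)] by (simp add: J_def lt_iff)
      then have "coherent \<eta> (t \<eta>) (\<lambda>_. m x, \<lambda>_. b x, \<lambda>_. r x) x" using mbr x(1) by blast
      then show ?thesis by (simp add: coherent_def split_beta)
    qed
    then show ?thesis using \<gamma>(1) by blast
  qed
  ultimately show ?thesis by blast
qed

lemma ex_stages:
  "\<exists>t. \<forall>\<xi>\<in>Field \<Xi>. stage \<xi> (t \<xi>) \<and>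
     (\<forall>\<eta>\<in>underS \<Xi> \<xi>. \<exists>\<beta>\<in>Field \<kappa>. \<forall>x\<in>Field \<kappa>. \<beta> \<sqsubseteq> x \<longrightarrow> coherent \<eta> (t \<eta>) (t \<xi>) x)"
proof -
  interpret X: regular_cardinal \<Xi> by (rule stages(1))
  define P where "P t \<xi> u \<longleftrightarrow> (\<xi> \<in> Field \<Xi> \<longrightarrow> stage \<xi> u \<and>
     (\<forall>\<eta>\<in>underS \<Xi> \<xi>. \<exists>\<beta>\<in>Field \<kappa>. \<forall>x\<in>Field \<kappa>. \<beta> \<sqsubseteq> x \<longrightarrow> coherent \<eta> (t \<eta>) u x))" for t \<xi> u
  have "\<exists>t. \<forall>\<xi>. P t \<xi> (t \<xi>)"
  proof (rule dependent_wf_choice[OF X.wf_lt])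
    fix t t' :: "'j \<Rightarrow> ('k \<Rightarrow> 'k) \<times> ('k \<Rightarrow> 'k) \<times> ('k \<Rightarrow> 'k \<Rightarrow> 'k)" and \<xi> u
    assume "\<And>\<eta>. (\<eta>, \<xi>) \<in> {(x, y). x \<in> underS \<Xi> y} \<Longrightarrow> t \<eta> = t' \<eta>"
    then have "\<And>\<eta>. \<eta> \<in> underS \<Xi> \<xi> \<Longrightarrow> t \<eta> = t' \<eta>" by simp
    then show "P t \<xi> u = P t' \<xi> u" by (simp add: P_def)
  next
    fix \<xi> and t :: "'j \<Rightarrow> ('k \<Rightarrow> 'k) \<times> ('k \<Rightarrow> 'k) \<times> ('k \<Rightarrow> 'k \<Rightarrow> 'k)"
    assume IH: "\<And>\<eta>. (\<eta>, \<xi>) \<in> {(x, y). x \<in> underS \<Xi> y} \<Longrightarrow> P t \<eta> (t \<eta>)"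
    show "\<exists>u. P t \<xi> u"
    proof (cases "\<xi> \<in> Field \<Xi>")
      case True
      have P: "P t \<eta> (t \<eta>)" and X: "\<eta> \<in> Field \<Xi>" if "\<eta> \<in> underS \<Xi> \<xi>" for \<eta>
        using IH that X.le_Field X.lt_iff by auto
      have "\<exists>u. stage \<xi> u \<and> (\<forall>\<eta>\<in>underS \<Xi> \<xi>. \<exists>\<beta>\<in>Field \<kappa>. \<forall>x\<in>Field \<kappa>. \<beta> \<sqsubseteq> x \<longrightarrow> coherent \<eta> (t \<eta>) u x)"
        by (rule extend_stages[OF True]) (use P X in \<open>auto simp: P_def\<close>)
      then show ?thesis by (auto simp: P_def)
    qed (simp add: P_def)
  qed
  then show ?thesis by (auto simp: P_def)
qed

end

text \<open>Every point of every block receives two coordinates, the flag telling source from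
  target. There are \<kappa> nonempty blocks, each inside \<kappa>, so these are exactly \<kappa>
  many.\<close>

lemma (in block_system) ex_code:
  "\<exists>code. bij_betw code (Sigma (Field \<kappa>) F \<times> (UNIV :: bool set)) (Field \<kappa>)"
proof -
  let ?W = "Sigma (Field \<kappa>) F \<times> (UNIV :: bool set)"
  have K: "|Field \<kappa>| =o \<kappa>" by (rule card_of_Field_ordIso[OF Card])
  have "Sigma (Field \<kappa>) F \<subseteq> Field \<kappa> \<times> Field \<kappa>" using F_Field by blast
  then have S: "|Sigma (Field \<kappa>) F| \<le>o \<kappa>"
    using ordLeq_ordIso_trans[OF card_of_mono1 ordIso_transitive[OF card_of_Times_same_infinite[OF infinite] K]]
    by blast
  have "|UNIV :: bool set| <o natLeq" using finite_iff_ordLess_natLeq[of "UNIV :: bool set"] by simp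
  moreover have "natLeq \<le>o \<kappa>"
    using infinite infinite_iff_natLeq_ordLeq[of "Field \<kappa>"] K ordLeq_ordIso_trans by blast
  ultimately have "|UNIV :: bool set| \<le>o \<kappa>" using ordLess_ordLeq_trans ordLess_imp_ordLeq by blast
  then have "|?W| \<le>o \<kappa>" using card_of_Times_ordLeq_infinite_Field[OF infinite S _ Card] by blast
  then have 1: "|?W| \<le>o |Field \<kappa>|" using K ordIso_symmetric ordLeq_ordIso_trans by blast
  have "\<forall>x\<in>Field \<kappa>. \<exists>y. y \<in> F x" using F_nonempty by blast
  then obtain h where h: "\<And>x. x \<in> Field \<kappa> \<Longrightarrow> h x \<in> F x" by metis
  have "inj_on (\<lambda>x. ((x, h x), True)) (Field \<kappa>)" by (auto simp: inj_on_def)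
  moreover have "(\<lambda>x. ((x, h x), True)) ` Field \<kappa> \<subseteq> ?W" using h by auto
  ultimately have "|Field \<kappa>| \<le>o |?W|" using card_of_ordLeq by blast
  then have "|?W| =o |Field \<kappa>|" using 1 ordIso_iff_ordLeq by blast
  then show ?thesis using card_of_ordIso by blast
qed

section \<open>Lifts have no small strong supports\<close>

locale coded_blocks = block_system \<kappa> \<Xi> F G
  for \<kappa> :: "'k rel" and \<Xi> :: "'j rel" and F G +
  fixes code :: "('k \<times> 'k) \<times> bool \<Rightarrow> 'k" and m b :: "'j \<Rightarrow> 'k \<Rightarrow> 'k" and r :: "'j \<Rightarrow> 'k \<Rightarrow> 'k \<Rightarrow> 'k"
  assumes code: "bij_betw code (Sigma (Field \<kappa>) F \<times> UNIV) (Field \<kappa>)"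
    and is_stage: "\<And>\<xi>. \<xi> \<in> Field \<Xi> \<Longrightarrow> stage \<xi> (m \<xi>, b \<xi>, r \<xi>)"
    and is_coherent: "\<And>\<xi> \<eta>. \<xi> \<in> Field \<Xi> \<Longrightarrow> \<eta> \<in> underS \<Xi> \<xi> \<Longrightarrow>
      \<exists>\<beta>\<in>Field \<kappa>. \<forall>x\<in>Field \<kappa>. (\<beta>, x) \<in> \<kappa> \<longrightarrow> coherent \<eta> (m \<eta>, b \<eta>, r \<eta>) (m \<xi>, b \<xi>, r \<xi>) x"
begin

section \<open>Sources and targets as coordinates\<close>

definition decode :: "'k \<Rightarrow> ('k \<times> 'k) \<times> bool" where
  "decode = inv_into (Sigma (Field \<kappa>) F \<times> UNIV) code"

definition block :: "'k \<Rightarrow> 'k" where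
  "block \<alpha> = fst (fst (decode \<alpha>))"

definition source :: "'k \<Rightarrow> 'k \<Rightarrow> 'k" where
  "source x y = code ((x, y), False)"

definition target :: "'k \<Rightarrow> 'k \<Rightarrow> 'k" where
  "target x y = code ((x, y), True)"

text \<open>Sources stay, and the target of \<open>y\<close> is read at the source of
  \<open>r \<xi> x y\<close>. This turns the maps of a stage into a retraction onto the sources that
  never leaves a block.\<close>

definition \<rho> :: "'j \<Rightarrow> 'k \<Rightarrow> 'k" where
  "\<rho> \<xi> \<alpha> = (case decode \<alpha> of ((x, y), c) \<Rightarrow> source x (if c then r \<xi> x y else y))"

lemma decode_code: "x \<in> Field \<kappa> \<Longrightarrow> y \<in> F x \<Longrightarrow> decode (code ((x, y), c)) = ((x, y), c)"
  using code unfolding decode_def bij_betw_def by (intro inv_into_f_f) auto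

lemma coordinate_cases:
  assumes "\<alpha> \<in> Field \<kappa>"
  obtains x y where "x \<in> Field \<kappa>" "y \<in> F x" "\<alpha> = source x y \<or> \<alpha> = target x y"
proof -
  obtain p where "p \<in> Sigma (Field \<kappa>) F \<times> UNIV" "\<alpha> = code p"
    using code assms unfolding bij_betw_def by blast
  then obtain x y c where "x \<in> Field \<kappa>" "y \<in> F x" "\<alpha> = code ((x, y), c)" by auto
  then show thesis using that by (cases c) (auto simp: source_def target_def)
qed

lemma source_target:
  assumes "x \<in> Field \<kappa>" "y \<in> F x"
  shows "source x y \<in> Field \<kappa>" "target x y \<in> Field \<kappa>" "block (source x y) = x" "block (target x y) = x"
    "\<rho> \<xi> (source x y) = source x y" "\<rho> \<xi> (target x y) = source x (r \<xi> x y)"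
  using assms code decode_code[OF assms] unfolding bij_betw_def
  by (auto simp: source_def target_def block_def \<rho>_def)

lemma source_inj:
  assumes "source x y = source x' y'" "x \<in> Field \<kappa>" "y \<in> F x" "x' \<in> Field \<kappa>" "y' \<in> F x'"
  shows "x = x'" "y = y'"
proof -
  have "decode (source x y) = decode (source x' y')" using assms(1) by simp
  then show "x = x'" "y = y'" using assms(2-5) by (simp_all add: source_def decode_code)
qed

lemma block_Field: "\<alpha> \<in> Field \<kappa> \<Longrightarrow> block \<alpha> \<in> Field \<kappa>"
  by (rule coordinate_cases) (auto simp: source_target)

lemma small_imp_bounded:
  assumes "S \<subseteq> Field \<kappa>" "|S| <o \<kappa>"
  obtains \<beta> where "\<beta> \<in> Field \<kappa>" "\<And>\<alpha>. \<alpha> \<in> S \<Longrightarrow> block \<alpha> \<sqsubset> \<beta>"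
  using image_bounded[OF assms(2), of block] block_Field assms(1) by (metis image_subsetI subsetD)

text \<open>Blocks are smaller than \<kappa> and \<kappa> is regular. Together with
  \<open>small_imp_bounded\<close> this lets "almost all coordinates" be read as "all coordinates in
  late blocks".\<close>

lemma bounded_imp_small:
  assumes "S \<subseteq> Field \<kappa>" "\<beta> \<in> Field \<kappa>" "\<And>\<alpha>. \<alpha> \<in> S \<Longrightarrow> block \<alpha> \<sqsubset> \<beta>"
  shows "|S| <o \<kappa>"
proof -
  have under: "x \<in> Field \<kappa>" if "x \<sqsubset> \<beta>" for x using that le_Field lt_iff by blast
  have "S \<subseteq> (\<Union>x\<in>underS \<kappa> \<beta>. source x ` F x \<union> target x ` F x)"
  proof
    fix \<alpha> assume \<alpha>: "\<alpha> \<in> S"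
    then obtain x y where xy: "x \<in> Field \<kappa>" "y \<in> F x" "\<alpha> = source x y \<or> \<alpha> = target x y"
      using assms(1) coordinate_cases by (metis subsetD)
    then have "x \<sqsubset> \<beta>" using assms(3)[OF \<alpha>] source_target(3,4) by metis
    then show "\<alpha> \<in> (\<Union>x\<in>underS \<kappa> \<beta>. source x ` F x \<union> target x ` F x)" using xy by blast
  qed
  moreover have "|\<Union>x\<in>underS \<kappa> \<beta>. source x ` F x \<union> target x ` F x| <o \<kappa>"
    using bounded_small[OF assms(2)] F_small under
    by (intro small_UN small_Un) (blast intro: ordLeq_ordLess_trans[OF card_of_image])+
  ultimately show ?thesis using small_subset by blast
qed

lemma stageD:
  assumes "\<xi> \<in> Field \<Xi>" "x \<in> Field \<kappa>"
  shows "m \<xi> x \<in> F x" "b \<xi> x \<in> F x" "m \<xi> x \<sqsubset> b \<xi> x" "r \<xi> x (m \<xi> x) = b \<xi> x"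
    "\<And>y. y \<in> F x \<Longrightarrow> r \<xi> x y \<in> F x" "\<And>y. y \<in> F x \<Longrightarrow> b \<xi> x \<sqsubseteq> y \<Longrightarrow> r \<xi> x y = y"
    "\<And>y. y \<in> F x \<Longrightarrow> {y} \<in> G \<xi> x \<Longrightarrow> y \<sqsubset> m \<xi> x"
  using is_stage[OF assms(1)] assms(2) by (auto simp: stage_def)

lemma \<rho>_cases:
  assumes "\<xi> \<in> Field \<Xi>" "\<alpha> \<in> Field \<kappa>"
  obtains y where "y \<in> F (block \<alpha>)" "\<rho> \<xi> \<alpha> = source (block \<alpha>) y"
  using assms(2)
proof (rule coordinate_cases)
  fix x y assume "x \<in> Field \<kappa>" "y \<in> F x" "\<alpha> = source x y \<or> \<alpha> = target x y"
  then show thesis using that stageD(5)[OF assms(1)] source_target by metis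
qed

text \<open>The stage \<eta> is one that captures the source slices \<open>S x\<close> of
  \<open>A\<close>. Coherence with \<eta> makes \<open>r \<xi> x\<close> and
  \<open>r \<eta> x\<close> agree on membership in these slices in all late blocks.\<close>

lemma \<rho>_stable:
  "\<exists>\<eta>\<in>Field \<Xi>. \<forall>\<xi>. (\<eta>, \<xi>) \<in> \<Xi> \<longrightarrow> |{\<alpha> \<in> Field \<kappa>. \<rho> \<xi> \<alpha> \<in> A \<longleftrightarrow> \<rho> \<eta> \<alpha> \<notin> A}| <o \<kappa>"
proof -
  interpret X: regular_cardinal \<Xi> by (rule stages(1))
  define S where "S x = {y \<in> F x. source x y \<in> A}" for x
  have "\<exists>\<eta>\<in>Field \<Xi>. \<exists>\<beta>\<in>Field \<kappa>. \<forall>x\<in>Field \<kappa>. \<beta> \<sqsubseteq> x \<longrightarrow> S x \<in> G \<eta> x"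
    using captured[of "{(x, y). source x y \<in> A}"] by (simp add: S_def)
  then obtain \<eta> \<beta> where \<eta>: "\<eta> \<in> Field \<Xi>" "\<beta> \<in> Field \<kappa>"
      "\<And>x. x \<in> Field \<kappa> \<Longrightarrow> \<beta> \<sqsubseteq> x \<Longrightarrow> S x \<in> G \<eta> x"
    by blast
  have "|{\<alpha> \<in> Field \<kappa>. \<rho> \<xi> \<alpha> \<in> A \<longleftrightarrow> \<rho> \<eta> \<alpha> \<notin> A}| <o \<kappa>" if \<xi>: "(\<eta>, \<xi>) \<in> \<Xi>" for \<xi>
  proof (cases "\<xi> = \<eta>")
    case True
    then show ?thesis using small_empty by simp
  next
    case False
    have \<xi>X: "\<xi> \<in> Field \<Xi>" using \<xi> X.le_Field by blast
    have "\<eta> \<in> underS \<Xi> \<xi>" using \<xi> False X.lt_iff by blast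
    then obtain \<gamma> where \<gamma>: "\<gamma> \<in> Field \<kappa>"
        "\<And>x. x \<in> Field \<kappa> \<Longrightarrow> \<gamma> \<sqsubseteq> x \<Longrightarrow> coherent \<eta> (m \<eta>, b \<eta>, r \<eta>) (m \<xi>, b \<xi>, r \<xi>) x"
      using is_coherent[OF \<xi>X] by metis
    obtain \<delta> where \<delta>: "\<delta> \<in> Field \<kappa>" "\<beta> \<sqsubset> \<delta>" "\<gamma> \<sqsubset> \<delta>" by (rule ex_upper2[OF \<eta>(2) \<gamma>(1)])
    have agree: "source x (r \<xi> x y) \<in> A \<longleftrightarrow> source x (r \<eta> x y) \<in> A"
      if x: "x \<in> Field \<kappa>" "\<delta> \<sqsubseteq> x" and y: "y \<in> F x" for x y
    proof -
      have "\<beta> \<sqsubseteq> x" "\<gamma> \<sqsubseteq> x" using \<delta> x(2) lt_iff le_trans by blast+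
      then have B: "S x \<in> G \<eta> x" and C: "coherent \<eta> (m \<eta>, b \<eta>, r \<eta>) (m \<xi>, b \<xi>, r \<xi>) x"
        using \<eta>(3)[OF x(1)] \<gamma>(2)[OF x(1)] by auto
      show ?thesis
      proof (cases "y \<sqsubset> b \<eta> x")
        case True
        then show ?thesis using C y by (simp add: coherent_def)
      next
        case False
        then have "b \<eta> x \<sqsubseteq> y" using not_lt F_Field[OF x(1)] y stageD(2)[OF \<eta>(1) x(1)] by blast
        then have "r \<xi> x y \<in> S x \<longleftrightarrow> y \<in> S x" "r \<eta> x y = y"
          using C B y stageD(6)[OF \<eta>(1) x(1)] by (auto simp: coherent_def)
        then show ?thesis using y stageD(5)[OF \<xi>X x(1) y] by (simp add: S_def)
      qed
    qed
    have "block \<alpha> \<sqsubset> \<delta>" if \<alpha>: "\<alpha> \<in> {\<alpha> \<in> Field \<kappa>. \<rho> \<xi> \<alpha> \<in> A \<longleftrightarrow> \<rho> \<eta> \<alpha> \<notin> A}" for \<alpha>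
    proof -
      have \<alpha>K: "\<alpha> \<in> Field \<kappa>" using \<alpha> by blast
      obtain x y where xy: "x \<in> Field \<kappa>" "y \<in> F x" "\<alpha> = source x y \<or> \<alpha> = target x y"
        by (rule coordinate_cases[OF \<alpha>K])
      then have "block \<alpha> = x" "\<not> \<delta> \<sqsubseteq> x" using \<alpha> agree source_target[OF xy(1,2)] by auto
      then show ?thesis using not_lt xy(1) \<delta>(1) by blast
    qed
    then show ?thesis by (intro bounded_imp_small[OF _ \<delta>(1)]) auto
  qed
  then show ?thesis using \<eta>(1) by blast
qed

text \<open>The point maps keep every block, so the preimage meets no block that the set itself
  misses.\<close>

lemma \<rho>_preimage:
  assumes "\<xi> \<in> Field \<Xi>" "S \<subseteq> Field \<kappa>" "|S| <o \<kappa>"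
  shows "|{\<alpha> \<in> Field \<kappa>. \<rho> \<xi> \<alpha> \<in> S}| <o \<kappa>"
proof -
  obtain \<beta> where \<beta>: "\<beta> \<in> Field \<kappa>" "\<And>\<alpha>. \<alpha> \<in> S \<Longrightarrow> block \<alpha> \<sqsubset> \<beta>"
    using small_imp_bounded[OF assms(2,3)] by blast
  have "block \<alpha> \<sqsubset> \<beta>" if "\<alpha> \<in> {\<alpha> \<in> Field \<kappa>. \<rho> \<xi> \<alpha> \<in> S}" for \<alpha>
  proof -
    have \<alpha>: "\<alpha> \<in> Field \<kappa>" "\<rho> \<xi> \<alpha> \<in> S" using that by auto
    then have "block (\<rho> \<xi> \<alpha>) = block \<alpha>"
      using \<rho>_cases[OF assms(1) \<alpha>(1)] source_target(3) block_Field by metis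
    then show ?thesis using \<beta>(2)[OF \<alpha>(2)] by simp
  qed
  then show ?thesis by (intro bounded_imp_small[OF _ \<beta>(1)]) auto
qed

definition sources :: "'k set" where
  "sources = {source x y |x y. x \<in> Field \<kappa> \<and> y \<in> F x}"

lemma card_sources: "|sources| =o \<kappa>"
proof -
  have sub: "sources \<subseteq> Field \<kappa>" using source_target(1) by (auto simp: sources_def)
  have "\<not> |sources| <o \<kappa>"
  proof
    assume "|sources| <o \<kappa>"
    then obtain \<beta> where \<beta>: "\<beta> \<in> Field \<kappa>" "\<And>\<alpha>. \<alpha> \<in> sources \<Longrightarrow> block \<alpha> \<sqsubset> \<beta>"
      using small_imp_bounded[OF sub] by blast
    obtain y where y: "y \<in> F \<beta>" using F_nonempty[OF \<beta>(1)] by blast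
    then have "source \<beta> y \<in> sources" using \<beta>(1) by (auto simp: sources_def)
    then show False using \<beta>(2) source_target(3)[OF \<beta>(1) y] lt_irrefl by metis
  qed
  moreover have "|sources| \<le>o \<kappa>"
    using card_of_mono1[OF sub] card_of_Field_ordIso[OF Card] ordLeq_ordIso_trans by blast
  ultimately show ?thesis using ordLeq_iff_ordLess_or_ordIso by blast
qed

text \<open>The two clauses of strong support are played against the lift. Where supports contain
  sources of larger points, clause (ii) changes the value at a target while its own source keeps its
  value. Otherwise clause (i) hides from some target the very source that late stages make it copy.
  A triangular choice produces such failures in cofinally many blocks at once.\<close>

lemma no_lift_with_small_supports:
  fixes U :: "('i, 'u) ualg" and \<Delta> :: "('k \<Rightarrow> 'u) \<Rightarrow> 'k \<Rightarrow> 'u"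
  defines "P \<equiv> \<Pi>\<^sub>E \<alpha>\<in>Field \<kappa>. ucarrier U"
  assumes U: "u\<^sub>0 \<in> ucarrier U" "u\<^sub>1 \<in> ucarrier U" "u\<^sub>0 \<noteq> u\<^sub>1"
    and lift: "\<And>\<sigma>. \<sigma> \<in> P \<Longrightarrow> \<exists>\<eta>\<in>Field \<Xi>. \<forall>\<xi>. (\<eta>, \<xi>) \<in> \<Xi> \<longrightarrow> |{\<alpha> \<in> Field \<kappa>. \<Delta> \<sigma> \<alpha> \<noteq> \<sigma> (\<rho> \<xi> \<alpha>)}| <o \<kappa>"
    and \<mu>: "\<mu> \<in> Field \<kappa>"
  shows "\<not> |{\<alpha> \<in> Field \<kappa>. \<not> (\<exists>Y. strong_support U (Field \<kappa>) (\<lambda>\<sigma>. \<Delta> \<sigma> \<alpha>) Y \<and> |Y| \<le>o |underS \<kappa> \<mu>| )}| <o \<kappa>"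
proof
  interpret X: regular_cardinal \<Xi> by (rule stages(1))
  let ?good = "\<lambda>\<alpha> Y. strong_support U (Field \<kappa>) (\<lambda>\<sigma>. \<Delta> \<sigma> \<alpha>) Y \<and> |Y| \<le>o |underS \<kappa> \<mu>|"
  assume "|{\<alpha> \<in> Field \<kappa>. \<not> (\<exists>Y. ?good \<alpha> Y)}| <o \<kappa>"
  then obtain \<beta>\<^sub>0 where \<beta>0: "\<beta>\<^sub>0 \<in> Field \<kappa>" "\<And>\<alpha>. \<alpha> \<in> {\<alpha> \<in> Field \<kappa>. \<not> (\<exists>Y. ?good \<alpha> Y)} \<Longrightarrow> block \<alpha> \<sqsubset> \<beta>\<^sub>0"
    by (rule small_imp_bounded[rotated]) auto
  \<comment> \<open>In a block \<open>x\<close> beyond this bound every target has a support of size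
    at most |\<mu>|, hence at most |x|, so the points of the block whose sources it contains are
    bounded in the block.\<close>
  obtain \<beta>\<^sub>1 where \<beta>1: "\<beta>\<^sub>1 \<in> Field \<kappa>" "\<beta>\<^sub>0 \<sqsubset> \<beta>\<^sub>1" "\<mu> \<sqsubset> \<beta>\<^sub>1" by (rule ex_upper2[OF \<beta>0(1) \<mu>])
  define Y where "Y x y = (SOME Y. ?good (target x y) Y)" for x y
  have Y: "?good (target x y) (Y x y)" if x: "x \<in> Field \<kappa>" "\<beta>\<^sub>1 \<sqsubset> x" and y: "y \<in> F x" for x y
  proof -
    have "\<not> x \<sqsubset> \<beta>\<^sub>0" using x(2) \<beta>1(2) lt_trans lt_irrefl by blast
    then have "\<exists>Y. ?good (target x y) Y"
      using \<beta>0(2)[of "target x y"] source_target(2,4)[OF x(1) y] by auto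
    then show ?thesis unfolding Y_def by (rule someI_ex)
  qed
  have PU: "ucarrier (upower U (Field \<kappa>)) = P" by (simp add: P_def upower_def)
  have supp: "\<Delta> \<sigma> (target x y) = \<Delta> \<tau> (target x y)"
    if "x \<in> Field \<kappa>" "\<beta>\<^sub>1 \<sqsubset> x" "y \<in> F x" "\<sigma> \<in> P" "\<tau> \<in> P" "\<And>i. i \<in> Y x y \<Longrightarrow> \<sigma> i = \<tau> i" for x y \<sigma> \<tau>
  proof -
    have "restrict \<sigma> (Y x y) = restrict \<tau> (Y x y)" using that(6) by (rule restrict_ext)
    then show ?thesis
      using Y[OF that(1-3)] that(4,5) unfolding strong_support_def PU by blast
  qed
  have strong: "\<exists>u\<in>ucarrier U. \<Delta> (\<sigma>(i := u)) (target x y) \<noteq> \<Delta> \<sigma> (target x y)"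
    if "x \<in> Field \<kappa>" "\<beta>\<^sub>1 \<sqsubset> x" "y \<in> F x" "\<sigma> \<in> P" "i \<in> Y x y" for x y \<sigma> i
    using Y[OF that(1-3)] that(4,5) unfolding strong_support_def PU by blast
  have YK: "Y x y \<subseteq> Field \<kappa>" if "x \<in> Field \<kappa>" "\<beta>\<^sub>1 \<sqsubset> x" "y \<in> F x" for x y
    using Y[OF that] unfolding strong_support_def by blast
  have Y_card: "|Y x y| \<le>o |underS \<kappa> x|" if "x \<in> Field \<kappa>" "\<beta>\<^sub>1 \<sqsubset> x" "y \<in> F x" for x y
  proof -
    have "underS \<kappa> \<mu> \<subseteq> underS \<kappa> x" using \<beta>1(3) that(2) lt_trans by blast
    then show ?thesis using Y[OF that] card_of_mono1 ordLeq_transitive by blast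
  qed

  \<comment> \<open>A block beyond all blocks touched by supports of targets in block
    \<open>x\<close>. It exists because the block and the supports are smaller than
    \<kappa>.\<close>
  define reach where "reach x = (SOME z. z \<in> Field \<kappa> \<and> x \<sqsubset> z \<and> (\<forall>y\<in>F x. \<forall>i\<in>Y x y. block i \<sqsubset> z))" for x
  have reach: "reach x \<in> Field \<kappa> \<and> x \<sqsubset> reach x \<and> (\<forall>y\<in>F x. \<forall>i\<in>Y x y. block i \<sqsubset> reach x)"
    if x: "x \<in> Field \<kappa>" "\<beta>\<^sub>1 \<sqsubset> x" for x
  proof -
    have "\<exists>z. z \<in> Field \<kappa> \<and> (\<forall>i\<in>Y x y. block i \<sqsubset> z)" if y: "y \<in> F x" for y
      using small_imp_bounded[OF YK[OF x y]] Y_card[OF x y] bounded_small[OF x(1)] ordLeq_ordLess_trans by metis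
    then obtain z where z: "\<And>y. y \<in> F x \<Longrightarrow> z y \<in> Field \<kappa> \<and> (\<forall>i\<in>Y x y. block i \<sqsubset> z y)" by metis
    have "z ` F x \<subseteq> Field \<kappa>" using z by blast
    then obtain z' where z': "z' \<in> Field \<kappa>" "\<And>y. y \<in> F x \<Longrightarrow> z y \<sqsubset> z'"
      by (rule image_bounded[OF F_small[OF x(1)]]) blast
    obtain z'' where z'': "z'' \<in> Field \<kappa>" "x \<sqsubset> z''" "z' \<sqsubset> z''" by (rule ex_upper2[OF x(1) z'(1)])
    have "block i \<sqsubset> z''" if "y \<in> F x" "i \<in> Y x y" for y i
      using z[OF that(1)] z'(2)[OF that(1)] z''(3) that(2) lt_trans by blast
    then show ?thesis unfolding reach_def using z'' by (intro someI_ex[of "\<lambda>z. z \<in> Field \<kappa> \<and> x \<sqsubset> z \<and> (\<forall>y\<in>F x. \<forall>i\<in>Y x y. block i \<sqsubset> z)"]) blast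
  qed
  \<comment> \<open>Thinning by \<open>reach\<close>: supports attached to a chosen block contain no
    source from a later chosen block.\<close>
  have sparse: "\<exists>X'\<subseteq>X. unbounded X' \<and> (\<forall>x\<in>X'. \<forall>x'\<in>X'. x' \<sqsubset> x \<longrightarrow> (\<forall>y'\<in>F x'. \<forall>y\<in>F x. source x y \<notin> Y x' y'))"
    if X: "unbounded X" "\<And>x. x \<in> X \<Longrightarrow> \<beta>\<^sub>1 \<sqsubset> x" for X
  proof -
    have XK: "X \<subseteq> Field \<kappa>" using X(1) by (simp add: unbounded_def)
    define h where "h x = (if x \<in> X then reach x else x)" for x
    have hK: "h ` Field \<kappa> \<subseteq> Field \<kappa>" using reach X(2) by (auto simp: h_def)
    obtain X' where X': "X' \<subseteq> X" "unbounded X'" "\<And>x x'. x \<in> X' \<Longrightarrow> x' \<in> X' \<Longrightarrow> x' \<sqsubset> x \<Longrightarrow> h x' \<sqsubset> x"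
      by (rule unbounded_sparse_subset[OF X(1) hK]) blast
    have "source x y \<notin> Y x' y'" if x: "x \<in> X'" "x' \<in> X'" "x' \<sqsubset> x" and y: "y' \<in> F x'" "y \<in> F x" for x x' y y'
    proof
      assume "source x y \<in> Y x' y'"
      moreover have "x' \<in> Field \<kappa>" "\<beta>\<^sub>1 \<sqsubset> x'" "x \<in> Field \<kappa>" using x X'(1) X(2) XK by auto
      ultimately have "x \<sqsubset> reach x'" using reach y source_target(3) by metis
      moreover have "reach x' \<sqsubset> x" using X'(3)[OF x] x(2) X'(1) by (auto simp: h_def)
      ultimately show False using lt_trans lt_irrefl by blast
    qed
    then show ?thesis using X' by blast
  qed
  have lift': "\<exists>\<eta>\<in>Field \<Xi>. \<forall>\<xi>. (\<eta>, \<xi>) \<in> \<Xi> \<longrightarrow> (\<exists>\<beta>\<in>Field \<kappa>. \<forall>x\<in>Field \<kappa>. \<forall>y\<in>F x. \<beta> \<sqsubseteq> x \<longrightarrow>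
      \<Delta> \<sigma> (target x y) = \<sigma> (source x (r \<xi> x y)))" if \<sigma>: "\<sigma> \<in> P" for \<sigma>
  proof -
    obtain \<eta> where \<eta>: "\<eta> \<in> Field \<Xi>" "\<And>\<xi>. (\<eta>, \<xi>) \<in> \<Xi> \<Longrightarrow> |{\<alpha> \<in> Field \<kappa>. \<Delta> \<sigma> \<alpha> \<noteq> \<sigma> (\<rho> \<xi> \<alpha>)}| <o \<kappa>"
      using lift[OF \<sigma>] by blast
    have "\<exists>\<beta>\<in>Field \<kappa>. \<forall>x\<in>Field \<kappa>. \<forall>y\<in>F x. \<beta> \<sqsubseteq> x \<longrightarrow> \<Delta> \<sigma> (target x y) = \<sigma> (source x (r \<xi> x y))"
      if \<xi>: "(\<eta>, \<xi>) \<in> \<Xi>" for \<xi>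
    proof -
      obtain \<beta> where \<beta>: "\<beta> \<in> Field \<kappa>" "\<And>\<alpha>. \<alpha> \<in> {\<alpha> \<in> Field \<kappa>. \<Delta> \<sigma> \<alpha> \<noteq> \<sigma> (\<rho> \<xi> \<alpha>)} \<Longrightarrow> block \<alpha> \<sqsubset> \<beta>"
        using small_imp_bounded[OF _ \<eta>(2)[OF \<xi>]] by blast
      have "\<Delta> \<sigma> (target x y) = \<sigma> (source x (r \<xi> x y))" if x: "x \<in> Field \<kappa>" "y \<in> F x" "\<beta> \<sqsubseteq> x" for x y
      proof -
        have "\<not> x \<sqsubset> \<beta>" using x(3) le_lt_trans lt_irrefl by blast
        then show ?thesis using \<beta>(2)[of "target x y"] source_target(2,4,6)[OF x(1,2)] by auto
      qed
      then show ?thesis using \<beta>(1) by blast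
    qed
    then show ?thesis using \<eta>(1) by blast
  qed

  \<comment> \<open>Points whose target can be influenced from the source of a larger point of the
    same block. The cases are whether \<open>D x\<close> is cofinal in the block for cofinally many
    \<open>x\<close>.\<close>
  define D where "D x = {y \<in> F x. \<exists>y'\<in>F x. y \<sqsubset> y' \<and> source x y' \<in> Y x y}" for x
  define X\<^sub>2 where "X\<^sub>2 = {x \<in> Field \<kappa>. \<beta>\<^sub>1 \<sqsubset> x \<and> (\<forall>c\<in>F x. \<exists>y\<in>D x. c \<sqsubset> y)}"
  have R_wf: "wf {(x, y). x \<sqsubset> y}" by (rule wf_lt)
  show False
  proof (cases "unbounded X\<^sub>2")
    case True
    then obtain X\<^sub>3 where X3: "X\<^sub>3 \<subseteq> X\<^sub>2" "unbounded X\<^sub>3"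
        "\<And>x x' y y'. x \<in> X\<^sub>3 \<Longrightarrow> x' \<in> X\<^sub>3 \<Longrightarrow> x' \<sqsubset> x \<Longrightarrow> y' \<in> F x' \<Longrightarrow> y \<in> F x \<Longrightarrow> source x y \<notin> Y x' y'"
      using sparse[OF True] unfolding X\<^sub>2_def by blast
    have x3: "x \<in> Field \<kappa>" "\<beta>\<^sub>1 \<sqsubset> x" "\<And>c. c \<in> F x \<Longrightarrow> \<exists>y\<in>D x. c \<sqsubset> y" if "x \<in> X\<^sub>3" for x
      using X3(1) that by (auto simp: X\<^sub>2_def)
    \<comment> \<open>The same thinning inside one block, where the regular cardinal is now the
      block itself and \<open>h\<close> bounds the points whose sources lie in a support.\<close>
    have "\<exists>T\<subseteq>D x. (\<forall>c\<in>F x. \<exists>y\<in>T. c \<sqsubset> y) \<and>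
        (\<forall>y\<in>T. \<forall>y'\<in>T. y' \<sqsubset> y \<longrightarrow> (\<forall>z\<in>F x. y \<sqsubset> z \<longrightarrow> source x z \<notin> Y x y'))" if x: "x \<in> X\<^sub>3" for x
    proof -
      note x' = x3[OF x]
      interpret B: regular_cardinal "Restr \<kappa> (F x)" by (rule F_regular[OF x'(1)])
      have FB: "Field (Restr \<kappa> (F x)) = F x" by (rule Field_Restr_F[OF x'(1)])
      have lt: "c \<in> underS (Restr \<kappa> (F x)) d \<longleftrightarrow> c \<sqsubset> d" if "c \<in> F x" "d \<in> F x" for c d
        using underS_Restr_F[OF x'(1) that(2)] that(1) by blast
      have DF: "D x \<subseteq> F x" by (auto simp: D_def)
      have D: "B.unbounded (D x)"
        unfolding B.unbounded_def FB using x'(3) DF lt by blast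
      have "\<exists>c\<in>F x. \<forall>z\<in>F x. source x z \<in> Y x y \<longrightarrow> z \<sqsubset> c" if y: "y \<in> F x" for y
      proof -
        let ?S = "{z \<in> F x. source x z \<in> Y x y}"
        have "inj_on (source x) ?S" using source_inj(2) x'(1) by (auto simp: inj_on_def)
        moreover have "source x ` ?S \<subseteq> Y x y" by auto
        ultimately have "|?S| \<le>o |Y x y|" using card_of_ordLeq by blast
        then have "|?S| \<le>o |underS \<kappa> x|" using Y_card[OF x'(1,2) y] ordLeq_transitive by blast
        then show ?thesis using F_bounded[OF x'(1), of ?S "\<lambda>z. z"] by auto
      qed
      then obtain h where h: "\<And>y. y \<in> F x \<Longrightarrow> h y \<in> F x"
          "\<And>y z. y \<in> F x \<Longrightarrow> z \<in> F x \<Longrightarrow> source x z \<in> Y x y \<Longrightarrow> z \<sqsubset> h y" by metis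
      have hF: "h ` Field (Restr \<kappa> (F x)) \<subseteq> Field (Restr \<kappa> (F x))" using h(1) FB by auto
      obtain T where T: "T \<subseteq> D x" "B.unbounded T"
          "\<And>y y'. y \<in> T \<Longrightarrow> y' \<in> T \<Longrightarrow> y' \<in> underS (Restr \<kappa> (F x)) y \<Longrightarrow> h y' \<in> underS (Restr \<kappa> (F x)) y"
        by (rule B.unbounded_sparse_subset[OF D hF]) blast
      have TF: "T \<subseteq> F x" using T(1) DF by blast
      have "source x z \<notin> Y x y'" if y: "y \<in> T" "y' \<in> T" "y' \<sqsubset> y" "z \<in> F x" "y \<sqsubset> z" for y y' z
      proof
        assume "source x z \<in> Y x y'"
        then have "z \<sqsubset> h y'" using h(2) y TF by blast
        moreover have "h y' \<sqsubset> y" using T(3) lt h(1) y TF by (metis subsetD)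
        ultimately show False using y(5) lt_trans lt_irrefl by blast
      qed
      moreover have "\<forall>c\<in>F x. \<exists>y\<in>T. c \<sqsubset> y"
        using T(2) lt TF unfolding B.unbounded_def FB by (metis subsetD)
      ultimately show ?thesis using T(1) by blast
    qed
    then obtain T where T: "\<And>x. x \<in> X\<^sub>3 \<Longrightarrow> T x \<subseteq> D x" "\<And>x c. x \<in> X\<^sub>3 \<Longrightarrow> c \<in> F x \<Longrightarrow> \<exists>y\<in>T x. c \<sqsubset> y"
        "\<And>x y y' z. x \<in> X\<^sub>3 \<Longrightarrow> y \<in> T x \<Longrightarrow> y' \<in> T x \<Longrightarrow> y' \<sqsubset> y \<Longrightarrow> z \<in> F x \<Longrightarrow> y \<sqsubset> z \<Longrightarrow> source x z \<notin> Y x y'"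
      by metis
    \<comment> \<open>\<open>z x y\<close> is a larger point whose source influences the target of
      \<open>y\<close>; that source becomes the reserved coordinate.\<close>
    have "\<exists>z. \<forall>x y. y \<in> D x \<longrightarrow> z x y \<in> F x \<and> y \<sqsubset> z x y \<and> source x (z x y) \<in> Y x y"
      unfolding D_def by (intro choice allI) blast
    then obtain z where z: "\<And>x y. y \<in> D x \<Longrightarrow> z x y \<in> F x \<and> y \<sqsubset> z x y \<and> source x (z x y) \<in> Y x y"
      by blast
    have TD: "y \<in> D x" "y \<in> F x" if "x \<in> X\<^sub>3" "y \<in> T x" for x y
      using T(1) that by (auto simp: D_def)
    \<comment> \<open>Blocks are compared first, then points of one block. Freshness comes from the
      choice of \<open>X\<^sub>3\<close> across blocks and of \<open>T\<close> within a
      block.\<close>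
    let ?R = "{(x, y). x \<sqsubset> y} <*lex*> {(x, y). x \<sqsubset> y}"
    have "\<exists>\<sigma>\<in>(\<Pi>\<^sub>E \<alpha>\<in>Field \<kappa>. ucarrier U). \<forall>w\<in>Sigma X\<^sub>3 T. (case w of (x, y) \<Rightarrow> \<Delta> \<sigma> (target x y) \<noteq> \<sigma> (source x y))"
    proof (rule triangular_choice[where R = ?R and z = "\<lambda>(x, y). source x (z x y)" and V = "\<lambda>(x, y). insert (source x y) (Y x y)"])
      show "wf ?R" using R_wf by (rule wf_lex_prod[OF R_wf])
      fix v assume v: "v \<in> Sigma X\<^sub>3 T"
      obtain x y where xy: "v = (x, y)" "x \<in> X\<^sub>3" "y \<in> T x" using v by auto
      note x' = x3[OF xy(2)] and y' = TD[OF xy(2,3)]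
      note zz = z[OF y'(1)]
      show "(case v of (x, y) \<Rightarrow> source x (z x y)) \<in> (case v of (x, y) \<Rightarrow> insert (source x y) (Y x y))"
        using zz xy(1) by simp
      show "(case v of (x, y) \<Rightarrow> source x (z x y)) \<in> Field \<kappa>"
        using zz xy(1) x'(1) source_target(1) by simp
      { fix w assume w: "w \<in> Sigma X\<^sub>3 T"
        then obtain x\<^sub>1 y\<^sub>1 where w': "w = (x\<^sub>1, y\<^sub>1)" "x\<^sub>1 \<in> X\<^sub>3" "y\<^sub>1 \<in> T x\<^sub>1" by auto
        note x1 = x3[OF w'(2)] and y1 = TD[OF w'(2,3)]
        show "(v, w) \<in> ?R \<or> (w, v) \<in> ?R" if "v \<noteq> w"
          using that xy(1) w'(1) lt_total[OF x'(1) x1(1)] lt_total[of y y\<^sub>1] F_Field[OF x'(1)] y'(2) y1(2) by auto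
        show "(case w of (x, y) \<Rightarrow> source x (z x y)) \<notin> (case v of (x, y) \<Rightarrow> insert (source x y) (Y x y))"
          if R: "(v, w) \<in> ?R"
        proof (cases "x = x\<^sub>1")
          case False
          then have "x \<sqsubset> x\<^sub>1" using R xy(1) w'(1) by auto
          then have "source x\<^sub>1 (z x\<^sub>1 y\<^sub>1) \<notin> Y x y" using X3(3)[OF w'(2) xy(2)] y'(2) z[OF y1(1)] by blast
          moreover have "source x\<^sub>1 (z x\<^sub>1 y\<^sub>1) \<noteq> source x y"
            using False source_inj(1) x1(1) x'(1) y'(2) z[OF y1(1)] by metis
          ultimately show ?thesis using xy(1) w'(1) by simp
        next
          case True
          then have lt: "y \<sqsubset> y\<^sub>1" using R xy(1) w'(1) lt_irrefl by auto
          have z1: "z x y\<^sub>1 \<in> F x" "y\<^sub>1 \<sqsubset> z x y\<^sub>1" using z[OF y1(1)] True by auto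
          have "source x (z x y\<^sub>1) \<notin> Y x y" using T(3)[OF xy(2) _ xy(3) lt z1] w'(3) True by blast
          moreover have "source x (z x y\<^sub>1) \<noteq> source x y"
            using source_inj(2)[of x "z x y\<^sub>1" x y] x'(1) y'(2) z1 lt lt_trans lt_irrefl by blast
          ultimately show ?thesis using xy(1) w'(1) True by simp
        qed }
      { fix \<sigma> assume \<sigma>: "\<sigma> \<in> (\<Pi>\<^sub>E \<alpha>\<in>Field \<kappa>. ucarrier U)"
        show "\<exists>c\<in>ucarrier U. (case v of (x, y) \<Rightarrow>
            \<Delta> (\<sigma>((case v of (x, y) \<Rightarrow> source x (z x y)) := c)) (target x y) \<noteq>
            (\<sigma>((case v of (x, y) \<Rightarrow> source x (z x y)) := c)) (source x y))"
        \<comment> \<open>If the values differ already, the reserved coordinate keeps its value. If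
          they agree, clause (ii) changes the value at the target, while \<open>source x y\<close>
          is another coordinate and keeps its value.\<close>
        proof (cases "\<Delta> \<sigma> (target x y) = \<sigma> (source x y)")
          case False
          have "\<sigma> (source x (z x y)) \<in> ucarrier U" using \<sigma> source_target(1) x'(1) zz by (auto simp: PiE_iff)
          then show ?thesis using False xy(1) by (intro bexI[of _ "\<sigma> (source x (z x y))"]) simp_all
        next
          case True
          have ne: "source x y \<noteq> source x (z x y)"
            using source_inj(2)[of x y x "z x y"] x'(1) y'(2) zz lt_irrefl by metis
          obtain c where "c \<in> ucarrier U" "\<Delta> (\<sigma>(source x (z x y) := c)) (target x y) \<noteq> \<Delta> \<sigma> (target x y)"
            using strong[OF x'(1,2) y'(2)] \<sigma> zz unfolding P_def by blast
          then show ?thesis using True ne xy(1) by (intro bexI[of _ c]) simp_all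
        qed
        fix \<tau> assume \<tau>: "\<tau> \<in> (\<Pi>\<^sub>E \<alpha>\<in>Field \<kappa>. ucarrier U)"
          and eq: "\<And>i. i \<in> (case v of (x, y) \<Rightarrow> insert (source x y) (Y x y)) \<Longrightarrow> \<sigma> i = \<tau> i"
          and bad: "case v of (x, y) \<Rightarrow> \<Delta> \<sigma> (target x y) \<noteq> \<sigma> (source x y)"
        have P: "\<sigma> \<in> P" "\<tau> \<in> P" using \<sigma> \<tau> by (simp_all add: P_def)
        have eq': "\<sigma> i = \<tau> i" if "i \<in> insert (source x y) (Y x y)" for i
          using eq[of i] that xy(1) by simp
        have "\<Delta> \<sigma> (target x y) = \<Delta> \<tau> (target x y)"
          using supp[OF x'(1,2) y'(2) P] eq' by blast
        then show "case v of (x, y) \<Rightarrow> \<Delta> \<tau> (target x y) \<noteq> \<tau> (source x y)"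
          using bad eq'[of "source x y"] xy(1) by simp }
    qed (rule U(1))
    then obtain \<sigma> where \<sigma>: "\<sigma> \<in> P" "\<And>x y. x \<in> X\<^sub>3 \<Longrightarrow> y \<in> T x \<Longrightarrow> \<Delta> \<sigma> (target x y) \<noteq> \<sigma> (source x y)"
      unfolding P_def by auto
    \<comment> \<open>\<open>T x\<close> has points above \<open>b \<eta> x\<close>, where
      \<open>r \<eta> x\<close> is the identity, so at their targets the lift must return the value
      of \<sigma> at their own sources.\<close>
    obtain \<eta> where \<eta>: "\<eta> \<in> Field \<Xi>" "\<exists>\<beta>\<in>Field \<kappa>. \<forall>x\<in>Field \<kappa>. \<forall>y\<in>F x. \<beta> \<sqsubseteq> x \<longrightarrow>
        \<Delta> \<sigma> (target x y) = \<sigma> (source x (r \<eta> x y))"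
      using lift'[OF \<sigma>(1)] X.le_refl by blast
    then obtain \<beta> where \<beta>: "\<beta> \<in> Field \<kappa>" "\<And>x y. x \<in> Field \<kappa> \<Longrightarrow> y \<in> F x \<Longrightarrow> \<beta> \<sqsubseteq> x \<Longrightarrow>
        \<Delta> \<sigma> (target x y) = \<sigma> (source x (r \<eta> x y))" by blast
    obtain x where x: "x \<in> X\<^sub>3" "\<beta> \<sqsubset> x" using X3(2) \<beta>(1) unfolding unbounded_def by blast
    obtain y where y: "y \<in> T x" "b \<eta> x \<sqsubset> y" using T(2)[OF x(1) stageD(2)[OF \<eta>(1) x3(1)[OF x(1)]]] by blast
    have "r \<eta> x y = y" using stageD(6)[OF \<eta>(1) x3(1)[OF x(1)] TD(2)[OF x(1) y(1)]] y(2) lt_iff by blast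
    then show False
      using \<sigma>(2)[OF x(1) y(1)] \<beta>(2)[OF x3(1)[OF x(1)] TD(2)[OF x(1) y(1)]] x(2) lt_iff by simp
  next
    case False
    have X2K: "X\<^sub>2 \<subseteq> Field \<kappa>" by (auto simp: X\<^sub>2_def)
    obtain \<beta>\<^sub>2 where \<beta>2: "\<beta>\<^sub>2 \<in> Field \<kappa>" "\<And>x. x \<in> X\<^sub>2 \<Longrightarrow> \<not> \<beta>\<^sub>2 \<sqsubset> x"
      using False X2K unfolding unbounded_def by blast
    obtain \<beta>\<^sub>3 where \<beta>3: "\<beta>\<^sub>3 \<in> Field \<kappa>" "\<beta>\<^sub>1 \<sqsubset> \<beta>\<^sub>3" "\<beta>\<^sub>2 \<sqsubset> \<beta>\<^sub>3" by (rule ex_upper2[OF \<beta>1(1) \<beta>2(1)])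
    have bound: "\<exists>c\<in>F x. \<forall>y\<in>D x. \<not> c \<sqsubset> y" if "x \<in> Field \<kappa>" "\<beta>\<^sub>3 \<sqsubset> x" for x
      using \<beta>2(2)[of x] \<beta>3(2,3) that lt_trans unfolding X\<^sub>2_def by blast
    define c where "c x = (SOME c. c \<in> F x \<and> (\<forall>y\<in>D x. \<not> c \<sqsubset> y))" for x
    have c: "c x \<in> F x" "\<And>y. y \<in> D x \<Longrightarrow> \<not> c x \<sqsubset> y" if "x \<in> Field \<kappa>" "\<beta>\<^sub>3 \<sqsubset> x" for x
      using someI_ex[of "\<lambda>c. c \<in> F x \<and> (\<forall>y\<in>D x. \<not> c \<sqsubset> y)"] bound[OF that] unfolding c_def by blast+
    \<comment> \<open>A stage that captures the graph of \<open>c\<close> has the singleton of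
      \<open>c x\<close> in \<open>G \<xi> x\<close> for late \<open>x\<close>. Its moved point then
      lies above \<open>c x\<close>, hence outside \<open>D x\<close>.\<close>
    obtain \<xi> \<beta>\<^sub>4 where \<xi>: "\<xi> \<in> Field \<Xi>" "\<beta>\<^sub>4 \<in> Field \<kappa>"
        "\<And>x. x \<in> Field \<kappa> \<Longrightarrow> \<beta>\<^sub>4 \<sqsubseteq> x \<Longrightarrow> {y \<in> F x. (x, y) \<in> range (\<lambda>x. (x, c x))} \<in> G \<xi> x"
      using captured[of "range (\<lambda>x. (x, c x))"] by blast
    obtain \<beta>\<^sub>5 where \<beta>5: "\<beta>\<^sub>5 \<in> Field \<kappa>" "\<beta>\<^sub>3 \<sqsubset> \<beta>\<^sub>5" "\<beta>\<^sub>4 \<sqsubset> \<beta>\<^sub>5" by (rule ex_upper2[OF \<beta>3(1) \<xi>(2)])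
    define M where "M = m \<xi>"
    define B where "B = b \<xi>"
    have MB: "M x \<in> F x" "B x \<in> F x" "M x \<sqsubset> B x" "r \<xi> x (M x) = B x" if "x \<in> Field \<kappa>" for x
      using stageD(1-4)[OF \<xi>(1) that] by (simp_all add: M_def B_def)
    \<comment> \<open>\<open>B x\<close> is larger than \<open>M x\<close>, so its source in the
      support would put \<open>M x\<close> into \<open>D x\<close>.\<close>
    have notin: "source x (B x) \<notin> Y x (M x)" if x: "x \<in> Field \<kappa>" "\<beta>\<^sub>5 \<sqsubset> x" for x
    proof
      assume "source x (B x) \<in> Y x (M x)"
      then have "M x \<in> D x" using MB[OF x(1)] unfolding D_def by blast
      have b: "\<beta>\<^sub>3 \<sqsubset> x" "\<beta>\<^sub>4 \<sqsubseteq> x" using \<beta>5(2,3) x(2) lt_trans lt_iff by blast+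
      have "{y \<in> F x. (x, y) \<in> range (\<lambda>x. (x, c x))} = {c x}" using c(1)[OF x(1) b(1)] by auto
      then have "c x \<sqsubset> M x" using \<xi>(3)[OF x(1) b(2)] stageD(7)[OF \<xi>(1) x(1) c(1)[OF x(1) b(1)]] by (simp add: M_def)
      then show False using c(2)[OF x(1) b(1) \<open>M x \<in> D x\<close>] by blast
    qed
    define X\<^sub>0 where "X\<^sub>0 = {x \<in> Field \<kappa>. \<beta>\<^sub>5 \<sqsubset> x}"
    have X0: "unbounded X\<^sub>0"
      unfolding unbounded_def X\<^sub>0_def
    proof (intro conjI ballI)
      fix d assume "d \<in> Field \<kappa>"
      then obtain e where "e \<in> Field \<kappa>" "\<beta>\<^sub>5 \<sqsubset> e" "d \<sqsubset> e" by (rule ex_upper2[OF \<beta>5(1)])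
      then show "\<exists>x\<in>{x \<in> Field \<kappa>. \<beta>\<^sub>5 \<sqsubset> x}. d \<sqsubset> x" by blast
    qed auto
    have X0': "\<beta>\<^sub>1 \<sqsubset> x" if "x \<in> X\<^sub>0" for x using that \<beta>5(2) \<beta>3(2) lt_trans unfolding X\<^sub>0_def by blast
    obtain X\<^sub>4 where X4: "X\<^sub>4 \<subseteq> X\<^sub>0" "unbounded X\<^sub>4"
        "\<And>x x' y y'. x \<in> X\<^sub>4 \<Longrightarrow> x' \<in> X\<^sub>4 \<Longrightarrow> x' \<sqsubset> x \<Longrightarrow> y' \<in> F x' \<Longrightarrow> y \<in> F x \<Longrightarrow> source x y \<notin> Y x' y'"
      using sparse[OF X0 X0'] by blast
    have x4: "x \<in> Field \<kappa>" "\<beta>\<^sub>5 \<sqsubset> x" "\<beta>\<^sub>1 \<sqsubset> x" if "x \<in> X\<^sub>4" for x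
      using X4(1) that X0' unfolding X\<^sub>0_def by blast+
    \<comment> \<open>The reserved coordinate is the source that the target of \<open>M x\<close>
      ought to copy.\<close>
    have "\<exists>\<sigma>\<in>(\<Pi>\<^sub>E \<alpha>\<in>Field \<kappa>. ucarrier U). \<forall>x\<in>X\<^sub>4. \<Delta> \<sigma> (target x (M x)) \<noteq> \<sigma> (source x (B x))"
    proof (rule triangular_choice[where R = "{(x, y). x \<sqsubset> y}" and z = "\<lambda>x. source x (B x)"
          and V = "\<lambda>x. insert (source x (B x)) (Y x (M x))"])
      show "wf {(x, y). x \<sqsubset> y}" by (rule R_wf)
      fix x assume x: "x \<in> X\<^sub>4"
      note x' = x4[OF x]
      show "source x (B x) \<in> insert (source x (B x)) (Y x (M x))" by simp
      show "source x (B x) \<in> Field \<kappa>" using source_target(1) x'(1) MB(2) by blast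
      { fix v assume v: "v \<in> X\<^sub>4"
        show "(x, v) \<in> {(x, y). x \<sqsubset> y} \<or> (v, x) \<in> {(x, y). x \<sqsubset> y}" if "x \<noteq> v"
          using lt_total[OF x'(1) x4(1)[OF v] that] by blast
        show "source v (B v) \<notin> insert (source x (B x)) (Y x (M x))" if "(x, v) \<in> {(x, y). x \<sqsubset> y}"
        proof -
          have lt: "x \<sqsubset> v" using that by simp
          have "source v (B v) \<notin> Y x (M x)" using X4(3)[OF v x lt] MB(1)[OF x'(1)] MB(2)[OF x4(1)[OF v]] by blast
          moreover have "source v (B v) \<noteq> source x (B x)"
            using source_inj(1)[of v "B v" x "B x"] x4(1)[OF v] x'(1) MB(2) lt lt_irrefl by blast
          ultimately show ?thesis by blast
        qed }
      { fix \<sigma> assume \<sigma>: "\<sigma> \<in> (\<Pi>\<^sub>E \<alpha>\<in>Field \<kappa>. ucarrier U)"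
        \<comment> \<open>The support misses the reserved coordinate, so the value at the target
          stays put while the coordinate is set to a different \<open>u\<close>; two elements of the
          carrier suffice for this.\<close>
        obtain u where u: "u \<in> ucarrier U" "\<Delta> \<sigma> (target x (M x)) \<noteq> u" using U by metis
        have "\<sigma>(source x (B x) := u) \<in> P"
          using \<sigma> u(1) source_target(1)[OF x'(1) MB(2)[OF x'(1)]] unfolding P_def by (auto simp: PiE_iff extensional_def)
        moreover have "\<sigma> i = (\<sigma>(source x (B x) := u)) i" if "i \<in> Y x (M x)" for i
          using notin[OF x'(1,2)] that by auto
        ultimately have "\<Delta> \<sigma> (target x (M x)) = \<Delta> (\<sigma>(source x (B x) := u)) (target x (M x))"
          using \<sigma> unfolding P_def[symmetric] by (intro supp[OF x'(1,3) MB(1)[OF x'(1)]]) auto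
        then show "\<exists>u\<in>ucarrier U. \<Delta> (\<sigma>(source x (B x) := u)) (target x (M x)) \<noteq> (\<sigma>(source x (B x) := u)) (source x (B x))"
          using u by (intro bexI[of _ u]) simp_all
        fix \<tau> assume \<tau>: "\<tau> \<in> (\<Pi>\<^sub>E \<alpha>\<in>Field \<kappa>. ucarrier U)"
          and eq: "\<And>i. i \<in> insert (source x (B x)) (Y x (M x)) \<Longrightarrow> \<sigma> i = \<tau> i"
          and bad: "\<Delta> \<sigma> (target x (M x)) \<noteq> \<sigma> (source x (B x))"
        have P: "\<sigma> \<in> P" "\<tau> \<in> P" using \<sigma> \<tau> by (simp_all add: P_def)
        have "\<Delta> \<sigma> (target x (M x)) = \<Delta> \<tau> (target x (M x))"
          using supp[OF x'(1,3) MB(1)[OF x'(1)] P] eq by blast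
        then show "\<Delta> \<tau> (target x (M x)) \<noteq> \<tau> (source x (B x))"
          using bad eq[of "source x (B x)"] by simp }
    qed (rule U(1))
    then obtain \<sigma> where \<sigma>: "\<sigma> \<in> P" "\<And>x. x \<in> X\<^sub>4 \<Longrightarrow> \<Delta> \<sigma> (target x (M x)) \<noteq> \<sigma> (source x (B x))"
      unfolding P_def by blast
    obtain \<eta> where \<eta>: "\<eta> \<in> Field \<Xi>" "\<And>\<zeta>. (\<eta>, \<zeta>) \<in> \<Xi> \<Longrightarrow> \<exists>\<beta>\<in>Field \<kappa>. \<forall>x\<in>Field \<kappa>. \<forall>y\<in>F x. \<beta> \<sqsubseteq> x \<longrightarrow>
        \<Delta> \<sigma> (target x y) = \<sigma> (source x (r \<zeta> x y))"
      using lift'[OF \<sigma>(1)] by blast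
    \<comment> \<open>The move made at \<xi> persists: as \<open>M x\<close> is below
      \<open>b \<xi> x\<close>, coherence gives \<open>r \<zeta> x (M x) = B x\<close> in late
      blocks. Being above \<eta> as well, \<zeta> computes the lift of \<sigma>.\<close>
    obtain \<zeta> where \<zeta>: "\<zeta> \<in> Field \<Xi>" "\<eta> \<in> underS \<Xi> \<zeta>" "\<xi> \<in> underS \<Xi> \<zeta>" by (rule X.ex_upper2[OF \<eta>(1) \<xi>(1)])
    obtain \<beta> where \<beta>: "\<beta> \<in> Field \<kappa>" "\<And>x y. x \<in> Field \<kappa> \<Longrightarrow> y \<in> F x \<Longrightarrow> \<beta> \<sqsubseteq> x \<Longrightarrow>
        \<Delta> \<sigma> (target x y) = \<sigma> (source x (r \<zeta> x y))"
      using \<eta>(2)[of \<zeta>] \<zeta>(2) X.lt_iff by blast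
    obtain \<gamma> where \<gamma>: "\<gamma> \<in> Field \<kappa>" "\<And>x. x \<in> Field \<kappa> \<Longrightarrow> \<gamma> \<sqsubseteq> x \<Longrightarrow> coherent \<xi> (m \<xi>, b \<xi>, r \<xi>) (m \<zeta>, b \<zeta>, r \<zeta>) x"
      using is_coherent[OF \<zeta>(1,3)] by blast
    obtain \<delta> where \<delta>: "\<delta> \<in> Field \<kappa>" "\<beta> \<sqsubset> \<delta>" "\<gamma> \<sqsubset> \<delta>" by (rule ex_upper2[OF \<beta>(1) \<gamma>(1)])
    obtain x where x: "x \<in> X\<^sub>4" "\<delta> \<sqsubset> x" using X4(2) \<delta>(1) unfolding unbounded_def by blast
    have xx: "x \<in> Field \<kappa>" "\<beta> \<sqsubseteq> x" "\<gamma> \<sqsubseteq> x" using x4(1)[OF x(1)] \<delta>(2,3) x(2) lt_trans lt_iff by blast+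
    have "r \<zeta> x (M x) = B x"
      using \<gamma>(2)[OF xx(1,3)] MB[OF xx(1)] by (simp add: coherent_def M_def B_def)
    then show False using \<beta>(2)[OF xx(1) MB(1)[OF xx(1)] xx(2)] \<sigma>(2)[OF x(1)] by simp
  qed
qed

end

section \<open>The block system of a dominating family\<close>

lemma inaccessible_regular:
  assumes "inaccessible \<kappa>"
  shows "regular_cardinal \<kappa>"
proof
  show Card: "Card_order \<kappa>" and "regularCard \<kappa>" using assms by (auto simp: inaccessible_def)
  have "natLeq \<le>o |Field \<kappa>|"
    using assms card_of_Field_ordIso[OF Card] ordLess_imp_ordLeq ordIso_symmetric ordLeq_ordIso_trans
    unfolding inaccessible_def by blast
  then show "\<not> finite (Field \<kappa>)" using infinite_iff_natLeq_ordLeq by blast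
qed

text \<open>The blocks are the ordinals \<open>f x\<close> themselves. The field of the power of
  \<open>ctwo\<close> consists of Boolean functions on the block, so a dominating family catches the
  characteristic functions of all slices.\<close>

lemma dagger_block_system:
  fixes \<kappa> :: "'k rel" and f g :: "'k \<Rightarrow> 'k"
  assumes "regular_cardinal \<kappa>" and dag: "dagger \<kappa> f g"
  shows "\<exists>G. block_system \<kappa> (cardSuc \<kappa>) (\<lambda>x. underS \<kappa> (f x)) G"
proof -
  interpret regular_cardinal \<kappa> by (rule assms(1))
  let ?F = "\<lambda>x. underS \<kappa> (f x)"
  let ?\<Xi> = "cardSuc \<kappa>"
  have f: "f x \<in> Field \<kappa>" "Card_order (seg \<kappa> (f x))" "\<not> finite (?F x)" "regularCard (seg \<kappa> (f x))"
    and g: "Card_order (seg \<kappa> (g x))" "\<not> finite (underS \<kappa> (g x))"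
    and power: "BNF_Cardinal_Arithmetic.ctwo ^c seg \<kappa> (g x) <o seg \<kappa> (f x)"
    if "x \<in> Field \<kappa>" for x
    using dag that by (auto simp: dagger_def cards_below_def Pi_iff cinfinite_def Field_seg)
  \<comment> \<open>Clause (2) bounds |\<nu>| only in the presence of a larger index, so one is
    supplied.\<close>
  have gx: "|underS \<kappa> x| \<le>o seg \<kappa> (g x)" if x: "x \<in> Field \<kappa>" for x
  proof -
    obtain x' where "x' \<in> Field \<kappa>" "x \<sqsubset> x'" by (rule ex_upper2[OF x x])
    then show ?thesis using dag by (auto simp: dagger_def)
  qed
  have g_f: "seg \<kappa> (g x) <o seg \<kappa> (f x)" if "x \<in> Field \<kappa>" for x
    using ordLess_ctwo_cexp[OF g(1)[OF that]] power[OF that] ordLess_transitive by blast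
  have reg: "regular_cardinal (seg \<kappa> (f x))" if "x \<in> Field \<kappa>" for x
    using f[OF that] by unfold_locales (simp_all add: Field_seg)
  obtain D where D: "dominating_family \<kappa> (\<lambda>\<nu>. BNF_Cardinal_Arithmetic.ctwo ^c seg \<kappa> (f \<nu>)) (\<lambda>\<nu>. seg \<kappa> (g \<nu>)) D"
      "|D| =o ?\<Xi>"
    using dag unfolding dagger_def dnum_is_def by blast
  have "|Field ?\<Xi>| =o |D|"
    using D(2) card_of_Field_ordIso[OF cardSuc_Card_order[OF Card]] ordIso_symmetric ordIso_transitive by blast
  then obtain e where e: "bij_betw e (Field ?\<Xi>) D" using card_of_ordIso by blast
  \<comment> \<open>The \<xi>-th member of the family, its Boolean functions read as subsets of the
    block.\<close>
  define G where "G \<xi> x = (\<lambda>B. {y \<in> ?F x. B y}) ` e \<xi> x" for \<xi> x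
  have eD: "|e \<xi> x| =o seg \<kappa> (g x)" if "\<xi> \<in> Field ?\<Xi>" "x \<in> Field \<kappa>" for \<xi> x
  proof -
    have "e \<xi> \<in> D" using e that(1) by (auto simp: bij_betw_def)
    then show ?thesis using D(1) that(2) unfolding dominating_family_def by (auto simp: PiE_iff)
  qed
  have bounded: "\<exists>c\<in>?F x. \<forall>s\<in>S. s \<sqsubset> c" if x: "x \<in> Field \<kappa>" and S: "S \<subseteq> ?F x" "|S| <o seg \<kappa> (f x)" for x S
  proof -
    obtain c where "c \<in> ?F x" "\<And>s. s \<in> S \<Longrightarrow> s \<in> underS (seg \<kappa> (f x)) c"
      using regular_cardinal.small_bounded[OF reg[OF x] _ S(2)] S(1) unfolding Field_seg by metis
    then show ?thesis unfolding seg_def by (auto simp: underS_def)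
  qed
  have no_max: "\<exists>d\<in>?F x. c \<sqsubset> d \<and> c' \<sqsubset> d" if x: "x \<in> Field \<kappa>" and c: "c \<in> ?F x" "c' \<in> ?F x" for x c c'
  proof -
    obtain d where "d \<in> ?F x" "c \<in> underS (seg \<kappa> (f x)) d" "c' \<in> underS (seg \<kappa> (f x)) d"
      using regular_cardinal.ex_upper2[OF reg[OF x]] c unfolding Field_seg by metis
    then show ?thesis unfolding seg_def by (auto simp: underS_def)
  qed
  have "block_system \<kappa> ?\<Xi> ?F G"
  proof (intro block_system.intro block_system_axioms.intro)
    show "regular_cardinal \<kappa>" by (rule assms(1))
    show "regular_cardinal ?\<Xi>" by (rule regular_cardSuc)
    show "\<kappa> <o ?\<Xi>" by (rule cardSuc_greater[OF Card])
    show "|underS ?\<Xi> \<xi>| \<le>o \<kappa>" if "\<xi> \<in> Field ?\<Xi>" for \<xi>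
      using card_of_underS[OF cardSuc_Card_order[OF Card] that]
        cardSuc_ordLeq_ordLess[OF Card card_of_Card_order] by blast
    show "?F x \<subseteq> Field \<kappa>" for x by (rule underS_Field)
    show "|?F x| <o \<kappa>" if "x \<in> Field \<kappa>" for x using bounded_small f(1)[OF that] .
    show "regular_cardinal (Restr \<kappa> (?F x))" if "x \<in> Field \<kappa>" for x
      using reg[OF that] by (simp add: seg_def)
    show "|underS \<kappa> x| <o Restr \<kappa> (?F x)" if "x \<in> Field \<kappa>" for x
      using ordLeq_ordLess_trans[OF gx[OF that] g_f[OF that]] by (simp add: seg_def)
  next
    fix x J c assume x: "x \<in> Field \<kappa>" and J: "J \<subseteq> Field ?\<Xi>" "|J| \<le>o |underS \<kappa> x|" and c: "c \<in> ?F x"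
    let ?g = "underS \<kappa> (g x)"
    \<comment> \<open>A union of at most g(x) sets of size g(x), so it has at most 2 to the g(x)
      subsets, fewer than f(x).\<close>
    define H where "H = (\<Union>\<eta>\<in>J. e \<eta> x)"
    have g': "|?g| =o seg \<kappa> (g x)" by (rule card_of_seg[OF g(1)[OF x]])
    have "|J| \<le>o |?g|"
      using J(2) gx[OF x] g' ordIso_symmetric ordLeq_ordIso_trans ordLeq_transitive by blast
    moreover have "\<forall>\<eta>\<in>J. |e \<eta> x| \<le>o |?g|"
      using eD[OF _ x] J(1) g' ordIso_symmetric ordIso_transitive ordIso_iff_ordLeq by blast
    ultimately have "|H| \<le>o |?g|" unfolding H_def by (rule card_of_UNION_ordLeq_infinite[OF g(2)[OF x]])
    then obtain h where h: "inj_on h H" "h ` H \<subseteq> ?g" unfolding card_of_ordLeq[symmetric] by blast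
    have "(`) h ` Pow H \<subseteq> Pow ?g" using h(2) by auto
    then have "|Pow H| \<le>o |Pow ?g|" using inj_on_image_Pow[OF h(1)] card_of_ordLeq by blast
    moreover have "|Pow ?g| =o BNF_Cardinal_Arithmetic.ctwo ^c seg \<kappa> (g x)"
      unfolding ctwo_def cexp_def Field_card_of Field_seg by (rule card_of_Pow_Func)
    ultimately have H: "|Pow H| <o seg \<kappa> (f x)"
      using power[OF x] ordLeq_ordIso_trans ordLeq_ordLess_trans by blast
    let ?S = "{y \<in> ?F x. c \<sqsubset> y}"
    let ?type = "\<lambda>y. {B \<in> H. B y}"
    \<comment> \<open>\<open>?S\<close> is a final segment of a regular block, hence unbounded, and
      so too large to be separated by fewer than f(x) types.\<close>
    have "\<not> inj_on ?type ?S"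
    proof
      assume "inj_on ?type ?S"
      moreover have "?type ` ?S \<subseteq> Pow H" by auto
      ultimately have "|?S| \<le>o |Pow H|" using card_of_ordLeq by blast
      then have "|?S| <o seg \<kappa> (f x)" using H ordLeq_ordLess_trans by blast
      then obtain d where d: "d \<in> ?F x" "\<And>s. s \<in> ?S \<Longrightarrow> s \<sqsubset> d" using bounded[OF x, of ?S] by blast
      obtain d' where "d' \<in> ?F x" "c \<sqsubset> d'" "d \<sqsubset> d'" using no_max[OF x c d(1)] by blast
      then show False using d(2)[of d'] lt_trans lt_irrefl by blast
    qed
    then obtain y y' where yy: "y \<in> ?S" "y' \<in> ?S" "?type y = ?type y'" "y \<noteq> y'" by (auto simp: inj_on_def)
    then have "y \<sqsubset> y' \<or> y' \<sqsubset> y" using lt_total underS_Field by blast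
    then obtain m b where mb: "m \<in> ?S" "b \<in> ?S" "?type m = ?type b" "m \<sqsubset> b"
    proof
      assume "y \<sqsubset> y'"
      then show thesis by (rule that[OF yy(1,2,3)])
    next
      assume "y' \<sqsubset> y"
      then show thesis by (rule that[OF yy(2,1) yy(3)[symmetric]])
    qed
    have "m \<in> B \<longleftrightarrow> b \<in> B" if B: "\<eta> \<in> J" "B \<in> G \<eta> x" for \<eta> B
    proof -
      obtain B' where B': "B' \<in> e \<eta> x" "B = {y \<in> ?F x. B' y}" using B(2) unfolding G_def by blast
      have "B' \<in> H" using B'(1) B(1) by (auto simp: H_def)
      then have "B' m \<longleftrightarrow> B' b" using mb(3) by blast
      then show ?thesis using B'(2) mb(1,2) by simp
    qed
    then show "\<exists>m\<in>?F x. \<exists>b\<in>?F x. c \<sqsubset> m \<and> m \<sqsubset> b \<and> (\<forall>\<eta>\<in>J. \<forall>B\<in>G \<eta> x. m \<in> B \<longleftrightarrow> b \<in> B)"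
      using mb(1,2,4) by blast
  next
    fix x \<xi> assume x: "x \<in> Field \<kappa>" and \<xi>: "\<xi> \<in> Field ?\<Xi>"
    \<comment> \<open>At most g(x) singletons occur in \<open>G \<xi> x\<close>, and g(x) is below
      the regular cardinal f(x).\<close>
    let ?S = "{y \<in> ?F x. {y} \<in> G \<xi> x}"
    have "inj_on (\<lambda>y. {y}) ?S" by simp
    moreover have "(\<lambda>y. {y}) ` ?S \<subseteq> G \<xi> x" by auto
    ultimately have "|?S| \<le>o |G \<xi> x|" using card_of_ordLeq by blast
    moreover have "|G \<xi> x| \<le>o |e \<xi> x|" unfolding G_def by (rule card_of_image)
    ultimately have "|?S| \<le>o seg \<kappa> (g x)"
      using eD[OF \<xi> x] ordLeq_transitive ordLeq_ordIso_trans by blast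
    then have "|?S| <o seg \<kappa> (f x)" using g_f[OF x] ordLeq_ordLess_trans by blast
    then obtain c where "c \<in> ?F x" "\<And>s. s \<in> ?S \<Longrightarrow> s \<sqsubset> c" using bounded[OF x, of ?S] by blast
    then show "\<exists>c\<in>?F x. \<forall>y\<in>?F x. {y} \<in> G \<xi> x \<longrightarrow> y \<sqsubseteq> c" using lt_iff by blast
  next
    fix A :: "('k \<times> 'k) set"
    \<comment> \<open>The characteristic functions of the slices of \<open>A\<close>, set to
      \<open>undefined\<close> outside the block as membership in \<open>Func\<close>
      demands.\<close>
    define h where "h = (\<lambda>x\<in>Field \<kappa>. \<lambda>y. if y \<in> ?F x then (x, y) \<in> A else undefined)"
    have h: "h \<in> (\<Pi>\<^sub>E x\<in>Field \<kappa>. Field (BNF_Cardinal_Arithmetic.ctwo ^c seg \<kappa> (f x)))"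
      unfolding ctwo_def cexp_def Field_card_of Field_seg by (auto simp: h_def Func_def)
    obtain d \<beta> where d: "d \<in> D" "\<beta> \<in> Field \<kappa>" "\<And>x. x \<in> Field \<kappa> - underS \<kappa> \<beta> \<Longrightarrow> h x \<in> d x"
      using bspec[OF conjunct2[OF D(1)[unfolded dominating_family_def]] h] by blast
    obtain \<xi> where \<xi>: "\<xi> \<in> Field ?\<Xi>" "e \<xi> = d" using e d(1) by (auto simp: bij_betw_def)
    have "{y \<in> ?F x. (x, y) \<in> A} \<in> G \<xi> x" if x: "x \<in> Field \<kappa>" "\<beta> \<sqsubseteq> x" for x
    proof -
      have "x \<notin> underS \<kappa> \<beta>" using x(2) le_lt_trans lt_irrefl by blast
      then have "h x \<in> e \<xi> x" using d(3) x(1) \<xi>(2) by blast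
      moreover have "{y \<in> ?F x. (x, y) \<in> A} = {y \<in> ?F x. h x y}" using x(1) by (auto simp: h_def)
      ultimately show ?thesis unfolding G_def by blast
    qed
    then show "\<exists>\<xi>\<in>Field ?\<Xi>. \<exists>\<beta>\<in>Field \<kappa>. \<forall>x\<in>Field \<kappa>. \<beta> \<sqsubseteq> x \<longrightarrow> {y \<in> ?F x. (x, y) \<in> A} \<in> G \<xi> x"
      using \<xi>(1) d(2) by blast
  qed
  then show ?thesis by blast
qed

section \<open>The projection and its lifts over an inaccessible cardinal\<close>

theorem theorem3p8:
  fixes \<kappa> :: "'k rel" and f g :: "'k \<Rightarrow> 'k" and U :: "('i, 'u) ualg"
  assumes "inaccessible \<kappa>"
    and "dagger \<kappa> f g"
    and "universal_algebra U"
    and "BNF_Cardinal_Arithmetic.ctwo \<le>o |ucarrier U|"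
    and "|ucarrier U| <o \<kappa>"
  defines "P \<equiv> upower U (Field \<kappa>)"
  defines "Q \<equiv> uquot P (sim U \<kappa>)"
  defines "p \<equiv> Equiv_Relations.proj (sim U \<kappa>)"
  shows "\<exists>E\<^sub>0 \<in> uhom Q Q.
    (\<forall>x\<in>ucarrier Q. E\<^sub>0 (E\<^sub>0 x) = E\<^sub>0 x) \<and>
    uisomorphic (uimage E\<^sub>0 Q Q) Q \<and>
    (\<forall>\<Delta>\<in>uhom P P. (\<forall>\<sigma>\<in>ucarrier P. p (\<Delta> \<sigma>) = E\<^sub>0 (p \<sigma>)) \<longrightarrow>
      (\<forall>\<mu>\<in>cards_below \<kappa>.
        |{\<alpha> \<in> Field \<kappa>. \<not> (\<exists>Y. strong_support U (Field \<kappa>) (\<lambda>\<sigma>. \<Delta> \<sigma> \<alpha>) Y \<and> |Y| \<le>o seg \<kappa> \<mu>)}| =o \<kappa>))"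
proof -
  let ?\<Xi> = "cardSuc \<kappa>" and ?F = "\<lambda>x. underS \<kappa> (f x)"
  have reg: "regular_cardinal \<kappa>" by (rule inaccessible_regular[OF assms(1)])
  obtain G where G: "block_system \<kappa> ?\<Xi> ?F G" using dagger_block_system[OF reg assms(2)] by blast
  interpret BS: block_system \<kappa> ?\<Xi> ?F G by (rule G)
  obtain code where code: "bij_betw code (Sigma (Field \<kappa>) ?F \<times> (UNIV :: bool set)) (Field \<kappa>)"
    using BS.ex_code by blast
  obtain t where t: "\<forall>\<xi>\<in>Field ?\<Xi>. BS.stage \<xi> (t \<xi>) \<and>
      (\<forall>\<eta>\<in>underS ?\<Xi> \<xi>. \<exists>\<beta>\<in>Field \<kappa>. \<forall>x\<in>Field \<kappa>. (\<beta>, x) \<in> \<kappa> \<longrightarrow> BS.coherent \<eta> (t \<eta>) (t \<xi>) x)"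
    using BS.ex_stages by blast
  interpret CB: coded_blocks \<kappa> ?\<Xi> ?F G code "\<lambda>\<xi>. fst (t \<xi>)" "\<lambda>\<xi>. fst (snd (t \<xi>))" "\<lambda>\<xi>. snd (snd (t \<xi>))"
    using code t by unfold_locales simp_all
  interpret A: algebra_congruence P "sim U \<kappa>" unfolding P_def by (rule BS.sim_congruence[OF assms(3)])
  \<comment> \<open>The point maps are those of the stages, and \<open>K\<close> is the set of
    sources.\<close>
  have "\<exists>E\<in>uhom Q Q. (\<forall>x\<in>ucarrier Q. E (E x) = E x) \<and> uisomorphic (uimage E Q Q) Q \<and>
    (\<forall>\<sigma>\<in>ucarrier P. \<exists>\<eta>\<in>Field ?\<Xi>. \<forall>\<xi>. (\<eta>, \<xi>) \<in> ?\<Xi> \<longrightarrow>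
      E (sim U \<kappa> `` {\<sigma>}) = sim U \<kappa> `` {BS.pull \<sigma> (CB.\<rho> \<xi>)})"
    unfolding Q_def P_def
  proof (rule BS.projection_of_point_maps[OF assms(3,5) BS.stages _ CB.card_sources])
    show "CB.sources \<subseteq> Field \<kappa>" using CB.source_target(1) by (auto simp: CB.sources_def)
    show "CB.\<rho> \<xi> \<alpha> \<in> CB.sources" if "\<xi> \<in> Field ?\<Xi>" "\<alpha> \<in> Field \<kappa>" for \<xi> \<alpha>
      using CB.\<rho>_cases[OF that] CB.block_Field[OF that(2)] unfolding CB.sources_def by blast
    show "CB.\<rho> \<xi> \<alpha> = \<alpha>" if "\<alpha> \<in> CB.sources" for \<xi> \<alpha>
      using that CB.source_target(5) by (auto simp: CB.sources_def)
    show "|{\<alpha> \<in> Field \<kappa>. CB.\<rho> \<xi> \<alpha> \<in> S}| <o \<kappa>" if "\<xi> \<in> Field ?\<Xi>" "S \<subseteq> Field \<kappa>" "|S| <o \<kappa>" for \<xi> S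
      by (rule CB.\<rho>_preimage[OF that])
    show "\<exists>\<eta>\<in>Field ?\<Xi>. \<forall>\<xi>. (\<eta>, \<xi>) \<in> ?\<Xi> \<longrightarrow> |{\<alpha> \<in> Field \<kappa>. CB.\<rho> \<xi> \<alpha> \<in> A \<longleftrightarrow> CB.\<rho> \<eta> \<alpha> \<notin> A}| <o \<kappa>" for A
      by (rule CB.\<rho>_stable)
  qed
  then obtain E where E: "E \<in> uhom Q Q" "\<forall>x\<in>ucarrier Q. E (E x) = E x" "uisomorphic (uimage E Q Q) Q"
      "\<And>\<sigma>. \<sigma> \<in> ucarrier P \<Longrightarrow> \<exists>\<eta>\<in>Field ?\<Xi>. \<forall>\<xi>. (\<eta>, \<xi>) \<in> ?\<Xi> \<longrightarrow>
        E (sim U \<kappa> `` {\<sigma>}) = sim U \<kappa> `` {BS.pull \<sigma> (CB.\<rho> \<xi>)}"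
    by blast
  obtain u :: "bool \<Rightarrow> 'u" where "inj u" "range u \<subseteq> ucarrier U"
    using assms(4) unfolding ctwo_def card_of_ordLeq[symmetric] by blast
  then have u: "u False \<in> ucarrier U" "u True \<in> ucarrier U" "u False \<noteq> u True" by (auto dest: injD)
  have "|{\<alpha> \<in> Field \<kappa>. \<not> (\<exists>Y. strong_support U (Field \<kappa>) (\<lambda>\<sigma>. \<Delta> \<sigma> \<alpha>) Y \<and> |Y| \<le>o seg \<kappa> \<mu>)}| =o \<kappa>"
    (is "|?N| =o \<kappa>")
    if \<Delta>: "\<Delta> \<in> uhom P P" "\<forall>\<sigma>\<in>ucarrier P. p (\<Delta> \<sigma>) = E (p \<sigma>)" and \<mu>: "\<mu> \<in> cards_below \<kappa>" for \<Delta> \<mu>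
  proof -
    have \<mu>': "\<mu> \<in> Field \<kappa>" "|underS \<kappa> \<mu>| =o seg \<kappa> \<mu>"
      using \<mu> BS.card_of_seg by (auto simp: cards_below_def)
    have lift: "\<exists>\<eta>\<in>Field ?\<Xi>. \<forall>\<xi>. (\<eta>, \<xi>) \<in> ?\<Xi> \<longrightarrow> |{\<alpha> \<in> Field \<kappa>. \<Delta> \<sigma> \<alpha> \<noteq> \<sigma> (CB.\<rho> \<xi> \<alpha>)}| <o \<kappa>"
      if \<sigma>: "\<sigma> \<in> (\<Pi>\<^sub>E \<alpha>\<in>Field \<kappa>. ucarrier U)" for \<sigma>
    proof -
      have \<sigma>P: "\<sigma> \<in> ucarrier P" using \<sigma> by (simp add: P_def upower_def)
      obtain \<eta> where \<eta>: "\<eta> \<in> Field ?\<Xi>"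
          "\<And>\<xi>. (\<eta>, \<xi>) \<in> ?\<Xi> \<Longrightarrow> E (sim U \<kappa> `` {\<sigma>}) = sim U \<kappa> `` {BS.pull \<sigma> (CB.\<rho> \<xi>)}"
        using E(4)[OF \<sigma>P] by blast
      have "|{\<alpha> \<in> Field \<kappa>. \<Delta> \<sigma> \<alpha> \<noteq> \<sigma> (CB.\<rho> \<xi> \<alpha>)}| <o \<kappa>" if \<xi>: "(\<eta>, \<xi>) \<in> ?\<Xi>" for \<xi>
      proof -
        \<comment> \<open>Any lift agrees with \<open>pull \<sigma> (CB.\<rho> \<xi>)\<close> off a
          small set, since both represent the same class; nothing else about \<Delta> enters the
          refutation.\<close>
        have "sim U \<kappa> `` {\<Delta> \<sigma>} = sim U \<kappa> `` {BS.pull \<sigma> (CB.\<rho> \<xi>)}"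
          using \<Delta>(2) \<sigma>P \<eta>(2)[OF \<xi>] by (simp add: p_def proj_def)
        moreover have "\<Delta> \<sigma> \<in> ucarrier P" using \<Delta>(1) \<sigma>P by (auto simp: uhom_def)
        moreover have "\<xi> \<in> Field ?\<Xi>" using \<xi> by (auto simp: Field_def)
        then have "BS.pull \<sigma> (CB.\<rho> \<xi>) \<in> ucarrier P"
          using CB.\<rho>_cases CB.block_Field CB.source_target(1) \<sigma>P unfolding P_def
          by (intro BS.pull_carrier) metis+
        ultimately have "(\<Delta> \<sigma>, BS.pull \<sigma> (CB.\<rho> \<xi>)) \<in> sim U \<kappa>"
          using eq_equiv_class[OF _ A.equiv] by blast
        then have "|{\<alpha> \<in> Field \<kappa>. \<Delta> \<sigma> \<alpha> \<noteq> BS.pull \<sigma> (CB.\<rho> \<xi>) \<alpha>}| <o \<kappa>" by (simp add: sim_def)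
        then show ?thesis by (rule BS.small_subset[rotated]) (auto simp: BS.pull_def)
      qed
      then show ?thesis using \<eta>(1) by blast
    qed
    have "|Y| \<le>o seg \<kappa> \<mu> \<longleftrightarrow> |Y| \<le>o |underS \<kappa> \<mu>|" for Y :: "'k set"
      using \<mu>'(2) ordIso_symmetric ordLeq_ordIso_trans by blast
    then have "\<not> |?N| <o \<kappa>"
      using CB.no_lift_with_small_supports[OF u lift \<mu>'(1)] by simp
    moreover have "|?N| \<le>o \<kappa>"
      using card_of_mono1[of ?N "Field \<kappa>"] card_of_Field_ordIso[OF BS.Card] ordLeq_ordIso_trans by blast
    ultimately show ?thesis using ordLeq_iff_ordLess_or_ordIso by blast
  qed
  then show ?thesis using E(1-3) by blast
qed

end
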